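(* Let $p:\mathbb{N}\to\mathbb{R}_{\ge1}$ be a polynomial, $0<\epsilon\le1$ a constant, and $\kappa$ a positive integer. There is an algorithm running in time $2^{O(n'/\kappa)}(n')^{O(1)}$ that, given a 3-SAT formula $\phi$ on variables $X_1,\dots,X_{n'}$ with $m=O(n')$ clauses $C_1,\dots,C_m$, computes an instance $\mathcal{I}$ of FR-$k$-Med-O of size $n$ such that: (1) $|C|=\kappa$, $|F|=\kappa\cdot2^{O(n'/\kappa)}$, $n=\kappa(2^{O(n'/\kappa)}+1)+1$, $k=\kappa$, and the number of groups is $t\le\kappa+2n'\kappa^2$; (2) if some assignment satisfies all clauses of $\phi$, then $\mathcal{I}$ has a feasible solution of cost at most $k$; (3) if every assignment satisfies fewer than a $(1-\epsilon)$ fraction of the clauses, then every feasible solution of $\mathcal{I}$ has cost $>p(n)\cdot k$.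
   Context: Fair-range $k$-median (FR-$k$-Med): an instance consists of positive integers $k,t$, clients $C$, facilities $F$, a metric $d$ on $C\cup F$ given as the shortest-path metric of a weighted graph $H$ whose vertex set contains $C\cup F$ ($n$ = number of vertices of $H$), groups $G_1,\dots,G_t\subseteq F$ (possibly intersecting) with integers $\alpha_i\le\beta_i$. A set $S\subseteq F$, $|S|\le k$, is feasible if $\alpha_i\le|S\cap G_i|\le\beta_i$ for all $i$; its cost is $\sum_{c\in C}d(c,S)$. FR-$k$-Med-O is FR-$k$-Med restricted to instances for which a feasible solution can be found in polynomial time. *)

theory Defs
  imports
    "HOL-Library.Log_Nat"
    "HOL-Library.Nat_Bijection"
    "HOL-Library.Extended_Real"
    "HOL-Computational_Algebra.Polynomial"
    "Graph_Theory.Shortest_Path"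
begin

section \<open>Model of computation\<close>

text \<open>
  Algorithms are programs of a random access machine with the operations addition, truncated
  subtraction, multiplication and division, under the logarithmic cost criterion (Aho, Hopcroft,
  Ullman, \<^emph>\<open>The Design and Analysis of Computer Algorithms\<close>, Section 1.3). This model and
  multitape Turing machines simulate each other with polynomial overhead. For readability the jump
  instructions are replaced by structured control flow and the memory is split into arrays: cell
  \<open>i\<close> of array \<open>a\<close> is \<open>s a i\<close>. A program mentions finitely many arrays, each by a fixed name, so
  this is the same as interleaving them in a single memory.
\<close>

type_synonym mem = "nat \<Rightarrow> nat \<Rightarrow> nat"

datatype exp =
    Const nat
  | Cell nat exp
  | Plus exp exp
  | Minus exp exp
  | Times exp exp
  | Div exp exp

datatype com =
    Skip
  | Assign nat exp exp
  | Write exp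
  | Seq com com
  | Cond exp com com
  | While exp com

text \<open>Number of binary digits, where 0 has one digit.\<close>

definition bits :: "nat \<Rightarrow> nat" where
  "bits n = max 1 (floorlog 2 n)"

fun val :: "mem \<Rightarrow> exp \<Rightarrow> nat" where
  "val s (Const n) = n"
| "val s (Cell a e) = s a (val s e)"
| "val s (Plus e f) = val s e + val s f"
| "val s (Minus e f) = val s e - val s f"
| "val s (Times e f) = val s e * val s f"
| "val s (Div e f) = val s e div val s f"

text \<open>Every evaluated subexpression is charged the length of its value. In particular, a memory
  access is charged for the address and for the content.\<close>

fun ecost :: "mem \<Rightarrow> exp \<Rightarrow> nat" where
  "ecost s (Const n) = bits n"
| "ecost s (Cell a e) = ecost s e + bits (val s (Cell a e))"
| "ecost s (Plus e f) = ecost s e + ecost s f + bits (val s (Plus e f))"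
| "ecost s (Minus e f) = ecost s e + ecost s f + bits (val s (Minus e f))"
| "ecost s (Times e f) = ecost s e + ecost s f + bits (val s (Times e f))"
| "ecost s (Div e f) = ecost s e + ecost s f + bits (val s (Div e f))"

text \<open>\<open>exec c (s, out) T (s', out')\<close>: started with memory \<open>s\<close> and output \<open>out\<close>, the program \<open>c\<close> halts
  after time \<open>T\<close> with memory \<open>s'\<close> and output \<open>out'\<close>. Conditions count as true if they are nonzero.\<close>

inductive exec :: "com \<Rightarrow> mem \<times> nat list \<Rightarrow> nat \<Rightarrow> mem \<times> nat list \<Rightarrow> bool" where
  Skip: "exec Skip z 1 z"
| Assign: "exec (Assign a e f) (s, out) (ecost s e + ecost s f)
     (s(a := (s a)(val s e := val s f)), out)"
| Write: "exec (Write e) (s, out) (ecost s e) (s, out @ [val s e])"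
| Seq: "exec c z T z' \<Longrightarrow> exec d z' T' z'' \<Longrightarrow> exec (Seq c d) z (T + T') z''"
| IfTrue: "val (fst z) e \<noteq> 0 \<Longrightarrow> exec c z T z' \<Longrightarrow> exec (Cond e c d) z (ecost (fst z) e + T) z'"
| IfFalse: "val (fst z) e = 0 \<Longrightarrow> exec d z T z' \<Longrightarrow> exec (Cond e c d) z (ecost (fst z) e + T) z'"
| WhileFalse: "val (fst z) e = 0 \<Longrightarrow> exec (While e c) z (ecost (fst z) e) z"
| WhileTrue: "val (fst z) e \<noteq> 0 \<Longrightarrow> exec c z T z' \<Longrightarrow> exec (While e c) z' T' z'' \<Longrightarrow>
     exec (While e c) z (ecost (fst z) e + T + T') z''"

text \<open>Initially array 0 holds the input, preceded by its length, and all other cells are 0.\<close>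

definition input_mem :: "nat list \<Rightarrow> mem" where
  "input_mem xs = (\<lambda>a i. if a = 0 \<and> i \<le> length xs then (length xs # xs) ! i else 0)"

definition runs :: "com \<Rightarrow> nat list \<Rightarrow> nat \<Rightarrow> nat list \<Rightarrow> bool" where
  "runs c xs T ys \<longleftrightarrow> (\<exists>s. exec c (input_mem xs, []) T (s, ys))"

definition input_size :: "nat list \<Rightarrow> nat" where
  "input_size xs = (\<Sum>x\<leftarrow>xs. bits x)"

definition enc_list :: "('a \<Rightarrow> nat list) \<Rightarrow> 'a list \<Rightarrow> nat list" where
  "enc_list f xs = length xs # concat (map f xs)"


section \<open>3-SAT\<close>

text \<open>The variables of a formula are \<open>0, \<dots>, num_vars - 1\<close>. Clauses have at most three literals.\<close>

datatype literal = Pos nat | Neg nat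

record cnf =
  num_vars :: nat
  clauses :: "literal list list"

fun var_of :: "literal \<Rightarrow> nat" where
  "var_of (Pos v) = v"
| "var_of (Neg v) = v"

fun lit_true :: "(nat \<Rightarrow> bool) \<Rightarrow> literal \<Rightarrow> bool" where
  "lit_true \<sigma> (Pos v) = \<sigma> v"
| "lit_true \<sigma> (Neg v) = (\<not> \<sigma> v)"

definition three_cnf :: "cnf \<Rightarrow> bool" where
  "three_cnf \<phi> \<longleftrightarrow> (\<forall>c \<in> set (clauses \<phi>). length c \<le> 3 \<and> (\<forall>l \<in> set c. var_of l < num_vars \<phi>))"

definition clause_sat :: "(nat \<Rightarrow> bool) \<Rightarrow> literal list \<Rightarrow> bool" where
  "clause_sat \<sigma> c \<longleftrightarrow> (\<exists>l \<in> set c. lit_true \<sigma> l)"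

definition num_sat :: "(nat \<Rightarrow> bool) \<Rightarrow> cnf \<Rightarrow> nat" where
  "num_sat \<sigma> \<phi> = length (filter (clause_sat \<sigma>) (clauses \<phi>))"

fun enc_literal :: "literal \<Rightarrow> nat list" where
  "enc_literal (Pos v) = [2 * v]"
| "enc_literal (Neg v) = [2 * v + 1]"

definition enc_cnf :: "cnf \<Rightarrow> nat list" where
  "enc_cnf \<phi> = num_vars \<phi> # enc_list (enc_list enc_literal) (clauses \<phi>)"


section \<open>Fair-range k-median\<close>

text \<open>
  The vertices of the graph are \<open>0, \<dots>, num_verts - 1\<close>. An edge \<open>(u, v, w)\<close> joins \<open>u\<close> and \<open>v\<close> and has
  weight \<open>w\<close>. A group \<open>(G, \<alpha>, \<beta>)\<close> consists of its facilities and its lower and upper bound.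
  Weights are rational so that instances have finite encodings.
\<close>

record fr_instance =
  bound_k :: nat
  num_verts :: nat
  clients :: "nat list"
  facilities :: "nat list"
  edges :: "(nat \<times> nat \<times> rat) list"
  groups :: "(nat list \<times> int \<times> int) list"

text \<open>The undirected graph as a symmetric digraph; an arc carries its weight as third component.\<close>

definition graph_of :: "fr_instance \<Rightarrow> (nat, nat \<times> nat \<times> rat) pre_digraph" where
  "graph_of I = \<lparr> verts = {0..<num_verts I},
     arcs = set (edges I) \<union> (\<lambda>(u, v, w). (v, u, w)) ` set (edges I),
     tail = (\<lambda>(u, v, w). u), head = (\<lambda>(u, v, w). v) \<rparr>"

definition dst :: "fr_instance \<Rightarrow> nat \<Rightarrow> nat \<Rightarrow> ereal" where
  "dst I = wf_digraph.\<mu> (graph_of I) (\<lambda>(u, v, w). real_of_rat w)"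

text \<open>Positive weights and connectedness make the shortest-path distance a metric on clients and
  facilities. Each undirected edge is listed once, with the smaller endpoint first.\<close>

definition fr_k_med :: "fr_instance \<Rightarrow> bool" where
  "fr_k_med I \<longleftrightarrow>
     bound_k I > 0 \<and> groups I \<noteq> [] \<and>
     distinct (clients I) \<and> distinct (facilities I) \<and>
     set (clients I) \<union> set (facilities I) \<subseteq> {0..<num_verts I} \<and>
     distinct (map (\<lambda>(u, v, w). (u, v)) (edges I)) \<and>
     (\<forall>(u, v, w) \<in> set (edges I). u < v \<and> v < num_verts I \<and> w > 0) \<and>
     (\<forall>x \<in> set (clients I) \<union> set (facilities I). \<forall>y \<in> set (clients I) \<union> set (facilities I).
        x \<rightarrow>\<^sup>*\<^bsub>graph_of I\<^esub> y) \<and>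
     (\<forall>(G, \<alpha>, \<beta>) \<in> set (groups I). distinct G \<and> set G \<subseteq> set (facilities I) \<and> \<alpha> \<le> \<beta>)"

definition feasible :: "fr_instance \<Rightarrow> nat set \<Rightarrow> bool" where
  "feasible I S \<longleftrightarrow> S \<subseteq> set (facilities I) \<and> card S \<le> bound_k I \<and>
     (\<forall>(G, \<alpha>, \<beta>) \<in> set (groups I). \<alpha> \<le> int (card (S \<inter> set G)) \<and> int (card (S \<inter> set G)) \<le> \<beta>)"

text \<open>The cost is extended-real valued; the distance to the empty set is infinite.\<close>

definition cost :: "fr_instance \<Rightarrow> nat set \<Rightarrow> ereal" where
  "cost I S = (\<Sum>c \<in> set (clients I). INF s \<in> S. dst I c s)"

definition enc_rat :: "rat \<Rightarrow> nat list" where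
  "enc_rat w = [int_encode (fst (quotient_of w)), int_encode (snd (quotient_of w))]"

definition enc_instance :: "fr_instance \<Rightarrow> nat list" where
  "enc_instance I =
     [bound_k I, num_verts I] @
     enc_list (\<lambda>v. [v]) (clients I) @
     enc_list (\<lambda>v. [v]) (facilities I) @
     enc_list (\<lambda>(u, v, w). u # v # enc_rat w) (edges I) @
     enc_list (\<lambda>(G, \<alpha>, \<beta>). enc_list (\<lambda>v. [v]) G @ [int_encode \<alpha>, int_encode \<beta>]) (groups I)"

text \<open>
  For a single instance it is meaningless to ask for a feasible solution in polynomial time. So a
  restriction of FR-k-Med to instances for which a feasible solution can be found in polynomial
  time is a set of instances on all of which one polynomial-time algorithm finds a feasible
  solution. The parameter \<open>bound_k\<close> is part of the input of that algorithm.
\<close>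

definition fr_k_med_O :: "fr_instance set \<Rightarrow> bool" where
  "fr_k_med_O \<O> \<longleftrightarrow> (\<forall>I \<in> \<O>. fr_k_med I) \<and>
     (\<exists>A (q :: nat poly). \<forall>I \<in> \<O>. \<exists>T ys.
        runs A (enc_instance I) T ys \<and> T \<le> poly q (input_size (enc_instance I)) \<and>
        feasible I (set ys))"


section \<open>Programs are deterministic and encodings are unambiguous\<close>

inductive_cases exec_elims:
  "exec Skip z T z'"
  "exec (Assign a e f) z T z'"
  "exec (Write e) z T z'"
  "exec (Seq c d) z T z'"
  "exec (Cond e c d) z T z'"
  "exec (While e c) z T z'"

lemma exec_deterministic:
  "exec c z T z' \<Longrightarrow> exec c z U z'' \<Longrightarrow> T = U \<and> z' = z''"
proof (induction arbitrary: U z'' rule: exec.induct)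
  case (Seq c z T z' d T' z'')
  from Seq.prems show ?case by (rule exec_elims) (use Seq.IH in blast)
next
  case (IfTrue z e c T z' d)
  from IfTrue.prems show ?case by (rule exec_elims) (metis IfTrue.IH IfTrue.hyps neq0_conv)+
next
  case (IfFalse z e d T z' c)
  from IfFalse.prems show ?case by (rule exec_elims) (metis IfFalse.IH IfFalse.hyps neq0_conv)+
next
  case (WhileFalse z e c)
  from WhileFalse.prems show ?case by (rule exec_elims) (metis WhileFalse.hyps neq0_conv)+
next
  case (WhileTrue z e c T z' T' z'')
  from WhileTrue.prems show ?case by (rule exec_elims) (metis WhileTrue.IH WhileTrue.hyps neq0_conv)+
qed (erule exec_elims, simp)+

lemma runs_deterministic: "runs c xs T ys \<Longrightarrow> runs c xs U zs \<Longrightarrow> T = U \<and> ys = zs"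
  unfolding runs_def using exec_deterministic by blast

lemma enc_list_append_inject:
  assumes "\<And>x y as bs. f x @ as = f y @ bs \<longleftrightarrow> x = y \<and> as = bs"
  shows "enc_list f xs @ as = enc_list f ys @ bs \<longleftrightarrow> xs = ys \<and> as = bs"
proof -
  have "xs = ys \<and> as = bs"
    if "length xs = length ys" "concat (map f xs) @ as = concat (map f ys) @ bs"
    using that by (induction xs ys rule: list_induct2) (auto simp: assms)
  then show ?thesis by (auto simp: enc_list_def)
qed

lemma enc_literal_append_inject:
  "enc_literal x @ as = enc_literal y @ bs \<longleftrightarrow> x = y \<and> as = bs"
  by (cases x; cases y; simp; presburger)

lemma inj_enc_cnf: "inj enc_cnf"
proof (rule injI)
  fix x y :: cnf
  assume "enc_cnf x = enc_cnf y"
  then have "num_vars x = num_vars y" "clauses x = clauses y"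
    using enc_list_append_inject[OF enc_list_append_inject[OF enc_literal_append_inject],
        of "clauses x" "[]" "clauses y" "[]"]
    by (auto simp: enc_cnf_def)
  then show "x = y" by simp
qed

lemma enc_rat_append_inject: "enc_rat x @ as = enc_rat y @ bs \<longleftrightarrow> x = y \<and> as = bs"
  by (auto simp: enc_rat_def int_encode_eq intro: quotient_of_inject prod_eqI)

lemma inj_enc_instance: "inj enc_instance"
proof (rule injI)
  fix x y :: fr_instance
  have nats: "enc_list (\<lambda>v::nat. [v]) vs @ as = enc_list (\<lambda>v. [v]) us @ bs \<longleftrightarrow> vs = us \<and> as = bs"
    for vs us as bs by (rule enc_list_append_inject) auto
  have edges: "enc_list (\<lambda>(u, v, w). u # v # enc_rat w) vs @ as =
      enc_list (\<lambda>(u, v, w). u # v # enc_rat w) us @ bs \<longleftrightarrow> vs = us \<and> as = bs" for vs us as bs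
    by (rule enc_list_append_inject) (auto simp: enc_rat_append_inject)
  have groups: "enc_list (\<lambda>(G, \<alpha>, \<beta>). enc_list (\<lambda>v::nat. [v]) G @ [int_encode \<alpha>, int_encode \<beta>]) vs @ as =
      enc_list (\<lambda>(G, \<alpha>, \<beta>). enc_list (\<lambda>v. [v]) G @ [int_encode \<alpha>, int_encode \<beta>]) us @ bs \<longleftrightarrow>
      vs = us \<and> as = bs" for vs us as bs
    by (rule enc_list_append_inject) (auto simp: nats int_encode_eq)
  assume "enc_instance x = enc_instance y"
  then show "x = y"
    using groups[of "groups x" "[]" "groups y" "[]"]
    by (auto simp: enc_instance_def nats edges)
qed

end

theory Submission
  imports Defs
begin

text \<open>
  Split the clauses into \<open>\<kappa>\<close> parts of at most \<open>g = \<lceil>m / \<kappa>\<rceil>\<close> clauses. The facilities of a part are the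
  \<open>2\<^sup>3\<^sup>g\<close> bit strings that assign a bit to each literal occurrence of the part, and its single
  client is close to a facility iff the corresponding partial assignment satisfies all clauses of the
  part; all other facilities are at distance at least \<open>W > p(n) \<kappa>\<close> from the client. For a variable \<open>v\<close> and
  parts \<open>i\<close>, \<open>i'\<close> there is a group with bounds 0 and 1 that consists of the facilities of part \<open>i\<close> that
  make \<open>v\<close> true and those of part \<open>i'\<close> that make it false. A feasible solution that is close to every
  client thus chooses mutually consistent satisfying partial assignments and yields a satisfying
  assignment. Choosing the all-zero string in each part is always feasible; these are the facilities
  \<open>0, \<dots>, \<kappa> - 1\<close>.
\<close>

section \<open>Time bounds for programs\<close>

text \<open>The gap comes from the edge weights alone: a single far client already costs
  \<open>W\<close>, so a solution of cost below \<open>W\<close> is close to all clients, and (3)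
  follows by contraposition from a fully satisfying assignment. Bits belong to literal occurrences
  because the place of an occurrence is computed from the number of its clause and its index in the
  clause, whereas the variables of a part would have to be renumbered. A string may therefore give
  different bits to occurrences of one variable. Only one occurrence per variable and part is ever
  read, so each string still defines at most one value for each variable. The program contains
  \<kappa>, but the constants hidden in the time bound must not depend on it. Running times are
  therefore bounded by powers of a number \<open>M\<close> that dominates the memory, with exponents
  read off the program text. Since \<open>M\<close> is polynomial in n' and \<kappa> up to the
  factor 2^(3 g) and g = O(max(1, n' / \<kappa>)), a fixed power of it has the required
  form.\<close>

fun val_deg :: "exp \<Rightarrow> nat" where
  "val_deg (Const n) = 1"
| "val_deg (Cell a e) = 1"
| "val_deg (Plus e f) = val_deg e + val_deg f"
| "val_deg (Minus e f) = val_deg e"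
| "val_deg (Times e f) = val_deg e + val_deg f"
| "val_deg (Div e f) = val_deg e"

fun ecost_deg :: "exp \<Rightarrow> nat" where
  "ecost_deg (Const n) = 1"
| "ecost_deg (Cell a e) = ecost_deg e + 1"
| "ecost_deg (Plus e f) = ecost_deg e + ecost_deg f + val_deg (Plus e f) + 1"
| "ecost_deg (Minus e f) = ecost_deg e + ecost_deg f + val_deg (Minus e f) + 1"
| "ecost_deg (Times e f) = ecost_deg e + ecost_deg f + val_deg (Times e f) + 1"
| "ecost_deg (Div e f) = ecost_deg e + ecost_deg f + val_deg (Div e f) + 1"

fun time_deg :: "com \<Rightarrow> nat" where
  "time_deg Skip = 1"
| "time_deg (Assign a e f) = ecost_deg e + ecost_deg f"
| "time_deg (Write e) = ecost_deg e"
| "time_deg (Seq c d) = time_deg c + time_deg d"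
| "time_deg (Cond e c d) = ecost_deg e + time_deg c + time_deg d"
| "time_deg (While e c) = ecost_deg e + time_deg c + 2"

fun consts_le :: "nat \<Rightarrow> exp \<Rightarrow> bool" where
  "consts_le M (Const n) \<longleftrightarrow> n \<le> M"
| "consts_le M (Cell a e) \<longleftrightarrow> consts_le M e"
| "consts_le M (Plus e f) \<longleftrightarrow> consts_le M e \<and> consts_le M f"
| "consts_le M (Minus e f) \<longleftrightarrow> consts_le M e \<and> consts_le M f"
| "consts_le M (Times e f) \<longleftrightarrow> consts_le M e \<and> consts_le M f"
| "consts_le M (Div e f) \<longleftrightarrow> consts_le M e \<and> consts_le M f"

definition mem_le :: "nat \<Rightarrow> mem \<Rightarrow> bool" where
  "mem_le M s \<longleftrightarrow> (\<forall>a i. s a i \<le> M)"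

lemma val_deg_pos: "0 < val_deg e"
  by (induction e) auto

lemma ecost_deg_pos: "0 < ecost_deg e"
  by (induction e) auto

lemma time_deg_pos: "0 < time_deg c"
  by (induction c) (auto simp: ecost_deg_pos)

text \<open>The base is \<open>M + 2\<close> so that every positive power is at least 2, and from 2
  on a sum is at most a product. Adding bounds thus costs only an addition of exponents.\<close>

lemma add_power_le:
  assumes "0 < p" "0 < q"
  shows "(M + 2 :: nat) ^ p + (M + 2) ^ q \<le> (M + 2) ^ (p + q)"
proof -
  have "x + y \<le> x * y" if "2 \<le> x" "2 \<le> y" for x y :: nat
  proof -
    have "x + y \<le> max x y * 2" by simp
    also have "\<dots> \<le> max x y * min x y" using that by (intro mult_le_mono) auto
    also have "\<dots> = x * y" by (simp add: max_def min_def)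
    finally show ?thesis .
  qed
  moreover have "2 \<le> (M + 2) ^ r" if "0 < r" for r
    using self_le_power[of "M + 2" r] that by auto
  ultimately show ?thesis using assms by (simp add: power_add)
qed

lemma add_power_le_mono:
  assumes "a \<le> (M + 2 :: nat) ^ p" "b \<le> (M + 2) ^ q" "0 < p" "0 < q"
  shows "a + b \<le> (M + 2) ^ (p + q)"
  using add_power_le[OF assms(3,4), of M] assms(1,2) by linarith

lemma val_le:
  assumes "mem_le M s" "consts_le M e"
  shows "val s e \<le> (M + 2) ^ val_deg e"
  using assms
proof (induction e)
  case (Cell a e)
  then show ?case by (auto simp: mem_le_def intro: order_trans[of _ M])
next
  case (Plus e f)
  then show ?case unfolding val.simps val_deg.simps
    by (intro add_power_le_mono val_deg_pos) auto
next
  case (Times e f)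
  then show ?case by (auto simp: power_add intro: mult_mono)
next
  case (Div e f)
  then show ?case by (auto intro: order_trans[OF div_le_dividend])
qed auto

text \<open>Giving up the logarithm only raises the exponent of \<open>M + 2\<close>, and a constant
  exponent is absorbed by the O in 2^O(n' / \<kappa>).\<close>

lemma bits_le: "bits n \<le> n + 1"
proof -
  have "floorlog 2 n \<le> n" by (rule floorlog_leI) auto
  then show ?thesis by (simp add: bits_def)
qed

lemma bits_pos: "1 \<le> bits n"
  by (simp add: bits_def)

lemma bits_val_le:
  assumes "mem_le M s" "consts_le M e"
  shows "bits (val s e) \<le> (M + 2) ^ (val_deg e + 1)"
proof -
  have "val s e + 1 \<le> (M + 2) ^ val_deg e + (M + 2) ^ 1"
    using val_le[OF assms] by simp
  also have "\<dots> \<le> (M + 2) ^ (val_deg e + 1)" by (intro add_power_le val_deg_pos) simp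
  finally show ?thesis using bits_le[of "val s e"] by linarith
qed

lemma ecost_le:
  assumes "mem_le M s" "consts_le M e"
  shows "ecost s e \<le> (M + 2) ^ ecost_deg e"
proof -
  have *: "ecost s e + ecost s f + bits (val s g) \<le> (M + 2) ^ (ecost_deg e + ecost_deg f + val_deg g + 1)"
    if "ecost s e \<le> (M + 2) ^ ecost_deg e" "ecost s f \<le> (M + 2) ^ ecost_deg f" "consts_le M g"
    for e f g
    using add_power_le_mono[OF add_power_le_mono[OF that(1,2)] bits_val_le[OF assms(1) that(3)]]
      ecost_deg_pos by (simp add: add.assoc)
  show ?thesis using assms(2)
  proof (induction e)
    case (Const n)
    then show ?case using bits_le[of n] by simp
  next
    case (Cell a e)
    have "bits (s a (val s e)) \<le> s a (val s e) + 1" by (rule bits_le)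
    also have "\<dots> \<le> (M + 2) ^ 1" using assms(1) by (simp add: mem_le_def le_SucI)
    finally show ?case unfolding ecost.simps ecost_deg.simps val.simps
      using Cell by (intro add_power_le_mono ecost_deg_pos) auto
  next
    case (Plus e f)
    then show ?case using *[of e f "Plus e f"] by simp
  next
    case (Minus e f)
    then show ?case using *[of e f "Minus e f"] by simp
  next
    case (Times e f)
    then show ?case using *[of e f "Times e f"] by simp
  next
    case (Div e f)
    then show ?case using *[of e f "Div e f"] by simp
  qed
qed

text \<open>Total correctness under the side condition that all cells stay at most \<open>M\<close>. The exponent of
  the time bound depends only on the syntax, because every loop below counts up to a stored number.\<close>

definition wp :: "nat \<Rightarrow> com \<Rightarrow> (mem \<Rightarrow> nat list \<Rightarrow> bool) \<Rightarrow> mem \<Rightarrow> nat list \<Rightarrow> bool" where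
  "wp M c R s out \<longleftrightarrow> (\<exists>T s' out'. exec c (s, out) T (s', out') \<and> T \<le> (M + 2) ^ time_deg c \<and>
     mem_le M s' \<and> R s' out')"

lemma wp_mono: "wp M c Q s out \<Longrightarrow> (\<And>s' out'. mem_le M s' \<Longrightarrow> Q s' out' \<Longrightarrow> R s' out') \<Longrightarrow> wp M c R s out"
  unfolding wp_def by blast

lemma wp_Skip: "mem_le M s \<Longrightarrow> R s out \<Longrightarrow> wp M Skip R s out"
  unfolding wp_def by (force intro: exec.Skip)

lemma wp_Assign:
  assumes "mem_le M s" "consts_le M e" "consts_le M f" "val s f \<le> M"
    and "R (s(a := (s a)(val s e := val s f))) out"
  shows "wp M (Assign a e f) R s out"
proof -
  have "mem_le M (s(a := (s a)(val s e := val s f)))"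
    using assms(1,4) by (simp add: mem_le_def)
  then show ?thesis
    unfolding wp_def time_deg.simps using exec.Assign assms(5)
      add_power_le_mono[OF ecost_le[OF assms(1,2)] ecost_le[OF assms(1,3)] ecost_deg_pos ecost_deg_pos]
    by blast
qed

lemma wp_Write:
  assumes "mem_le M s" "consts_le M e" "R s (out @ [val s e])"
  shows "wp M (Write e) R s out"
  unfolding wp_def time_deg.simps
  using assms(1,3) exec.Write ecost_le[OF assms(1,2)] by blast

lemma wp_Seq:
  assumes "wp M c (wp M d R) s out"
  shows "wp M (Seq c d) R s out"
proof -
  obtain T s' out' where c: "exec c (s, out) T (s', out')" "T \<le> (M + 2) ^ time_deg c"
    and "wp M d R s' out'" using assms unfolding wp_def by blast
  then obtain T' s'' out'' where d: "exec d (s', out') T' (s'', out'')" "T' \<le> (M + 2) ^ time_deg d"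
      "mem_le M s''" "R s'' out''" unfolding wp_def by blast
  show ?thesis unfolding wp_def time_deg.simps
    using exec.Seq[OF c(1) d(1)] add_power_le_mono[OF c(2) d(2) time_deg_pos time_deg_pos] d(3,4)
    by blast
qed

lemma wp_Cond:
  assumes "mem_le M s" "consts_le M e"
    and "val s e \<noteq> 0 \<Longrightarrow> wp M c R s out" "val s e = 0 \<Longrightarrow> wp M d R s out"
  shows "wp M (Cond e c d) R s out"
proof -
  note e = ecost_le[OF assms(1,2)]
  note b = add_power_le_mono[OF e _ ecost_deg_pos]
  have up: "(M + 2) ^ (ecost_deg e + time_deg x) \<le> (M + 2) ^ (ecost_deg e + time_deg c + time_deg d)"
    if "time_deg x \<le> time_deg c + time_deg d" for x
    by (rule power_increasing) (use that in simp_all)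
  show ?thesis
  proof (cases "val s e = 0")
    case True
    with assms(4) obtain T s' out' where d: "exec d (s, out) T (s', out')" "T \<le> (M + 2) ^ time_deg d"
      "mem_le M s'" "R s' out'" unfolding wp_def by blast
    have "exec (Cond e c d) (s, out) (ecost s e + T) (s', out')"
      using exec.IfFalse[of "(s, out)" e, OF _ d(1)] True by simp
    moreover have "ecost s e + T \<le> (M + 2) ^ time_deg (Cond e c d)"
      unfolding time_deg.simps by (rule order_trans[OF b[OF d(2) time_deg_pos] up]) simp
    ultimately show ?thesis unfolding wp_def using d(3,4) by blast
  next
    case False
    with assms(3) obtain T s' out' where d: "exec c (s, out) T (s', out')" "T \<le> (M + 2) ^ time_deg c"
      "mem_le M s'" "R s' out'" unfolding wp_def by blast
    have "exec (Cond e c d) (s, out) (ecost s e + T) (s', out')"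
      using exec.IfTrue[of "(s, out)" e, OF _ d(1)] False by simp
    moreover have "ecost s e + T \<le> (M + 2) ^ time_deg (Cond e c d)"
      unfolding time_deg.simps by (rule order_trans[OF b[OF d(2) time_deg_pos] up]) simp
    ultimately show ?thesis unfolding wp_def using d(3,4) by blast
  qed
qed

text \<open>The invariant is indexed by the number of completed rounds. Hence \<open>n\<close> is
  the exact number of rounds, and termination needs no separate variant.\<close>

lemma wp_While:
  assumes "mem_le M s" "consts_le M e" "n \<le> M" "I 0 s out"
    and "\<And>i s out. i < n \<Longrightarrow> mem_le M s \<Longrightarrow> I i s out \<Longrightarrow> val s e \<noteq> 0 \<and> wp M c (I (Suc i)) s out"
    and "\<And>s out. mem_le M s \<Longrightarrow> I n s out \<Longrightarrow> val s e = 0"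
  shows "wp M (While e c) (I n) s out"
proof -
  let ?E = "(M + 2) ^ ecost_deg e" and ?C = "(M + 2) ^ time_deg c"
  have "\<exists>T s' out'. exec (While e c) (s, out) T (s', out') \<and> T \<le> (n - i) * (?E + ?C) + ?E \<and>
     mem_le M s' \<and> I n s' out'" if "i \<le> n" "mem_le M s" "I i s out" for i s out
    using that
  proof (induction "n - i" arbitrary: i s out)
    case 0
    then show ?case using exec.WhileFalse[of "(s, out)" e c] assms(6) ecost_le[OF \<open>mem_le M s\<close> assms(2)]
      by (intro exI[of _ "ecost s e"] exI[of _ s] exI[of _ out]) auto
  next
    case (Suc k)
    then have i: "i < n" by simp
    obtain T s' out' where e: "val s e \<noteq> 0" and c: "exec c (s, out) T (s', out')" "T \<le> ?C"
      "mem_le M s'" "I (Suc i) s' out'"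
      using assms(5)[OF i Suc.prems(2,3)] unfolding wp_def by blast
    have "k = n - Suc i" using Suc.hyps(2) by simp
    then obtain T' s'' out'' where w: "exec (While e c) (s', out') T' (s'', out'')"
      "T' \<le> (n - Suc i) * (?E + ?C) + ?E" "mem_le M s''" "I n s'' out''"
      using Suc.hyps(1)[OF _ _ c(3,4)] Suc_leI[OF i] by blast
    have "exec (While e c) (s, out) (ecost s e + T + T') (s'', out'')"
      using exec.WhileTrue[of "(s, out)" e, OF _ c(1) w(1)] e by simp
    moreover have "ecost s e + T + T' \<le> (n - i) * (?E + ?C) + ?E"
    proof -
      have "n - i = Suc (n - Suc i)" using i by simp
      then show ?thesis using ecost_le[OF Suc.prems(2) assms(2)] c(2) w(2) by simp
    qed
    ultimately show ?case using w(3,4) by blast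
  qed
  from this[of 0 s out] obtain T s' out' where T: "exec (While e c) (s, out) T (s', out')"
    "T \<le> n * (?E + ?C) + ?E" "mem_le M s'" "I n s' out'" using assms(1,4) by auto
  \<comment> \<open>At most \<open>M\<close> rounds and one last test; a factor \<open>M + 2\<close>
    in the degree of a loop pays for them.\<close>
  have "n * (?E + ?C) + ?E \<le> (M + 1) * (?E + ?C)"
    using mult_le_mono1[OF \<open>n \<le> M\<close>, of "?E + ?C"]
    unfolding add_mult_distrib[of M 1] mult_1 by linarith
  also have "\<dots> \<le> (M + 2) * (M + 2) ^ (ecost_deg e + time_deg c)"
    by (intro mult_le_mono add_power_le ecost_deg_pos time_deg_pos) simp
  also have "\<dots> \<le> (M + 2) ^ (ecost_deg e + time_deg c + 2)" by (simp add: power_add)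
  finally show ?thesis using T unfolding wp_def time_deg.simps by (meson order_trans)
qed

text \<open>Cell 0 of array \<open>x\<close> is the loop counter and cell 1 stores the bound.\<close>

definition For :: "nat \<Rightarrow> exp \<Rightarrow> com \<Rightarrow> com" where
  "For x e c = Seq (Assign x (Const 1) e) (Seq (Assign x (Const 0) (Const 0))
     (While (Minus (Cell x (Const 1)) (Cell x (Const 0)))
       (Seq c (Assign x (Const 0) (Plus (Cell x (Const 0)) (Const 1))))))"

text \<open>The counter and the bound live in array \<open>x\<close>. They survive the body because
  it must restore that array, and updating them is harmless because the invariant is insensitive to
  it.\<close>

lemma wp_For:
  assumes "mem_le M s" "consts_le M e" "val s e = n" "n \<le> M" "1 \<le> M"
    and "\<And>i s out f. I i s out \<Longrightarrow> I i (s(x := f)) out"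
    and "I 0 s out"
    and "\<And>i s out. i < n \<Longrightarrow> mem_le M s \<Longrightarrow> I i s out \<Longrightarrow> s x 0 = i \<Longrightarrow>
      wp M c (\<lambda>s' out'. I (Suc i) s' out' \<and> s' x = s x) s out"
    and "\<And>s out. mem_le M s \<Longrightarrow> I n s out \<Longrightarrow> R s out"
  shows "wp M (For x e c) R s out"
proof -
  let ?J = "\<lambda>i s out. I i s out \<and> s x 0 = i \<and> s x 1 = n"
  let ?s = "s(x := (s x)(1 := n, 0 := 0))"
  have "wp M (While (Minus (Cell x (Const 1)) (Cell x (Const 0)))
       (Seq c (Assign x (Const 0) (Plus (Cell x (Const 0)) (Const 1))))) (?J n) ?s out"
  proof (rule wp_While[where I = ?J])
    show "mem_le M ?s" using assms(1,4) by (auto simp: mem_le_def)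
    show "?J 0 ?s out" using assms(6)[OF assms(7), of "(s x)(1 := n, 0 := 0)"] by simp
    fix i s out assume i: "i < n" "mem_le M s" "?J i s out"
    show "val s (Minus (Cell x (Const 1)) (Cell x (Const 0))) \<noteq> 0 \<and>
      wp M (Seq c (Assign x (Const 0) (Plus (Cell x (Const 0)) (Const 1)))) (?J (Suc i)) s out"
    proof (intro conjI wp_Seq)
      show "wp M c (wp M (Assign x (Const 0) (Plus (Cell x (Const 0)) (Const 1))) (?J (Suc i))) s out"
      proof (rule wp_mono[OF assms(8)[of i s out]])
        fix s' out' assume "mem_le M s'" "I (Suc i) s' out' \<and> s' x = s x"
        then show "wp M (Assign x (Const 0) (Plus (Cell x (Const 0)) (Const 1))) (?J (Suc i)) s' out'"
          using i assms(4,5,6) by (intro wp_Assign) auto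
      qed (use i in auto)
    qed (use i in auto)
  qed (use assms in auto)
  then have w: "wp M (While (Minus (Cell x (Const 1)) (Cell x (Const 0)))
       (Seq c (Assign x (Const 0) (Plus (Cell x (Const 0)) (Const 1))))) R ?s out"
    by (rule wp_mono) (use assms(9) in auto)
  show ?thesis unfolding For_def
    using assms(1-5) w
    by (intro wp_Seq wp_Assign) (auto simp: mem_le_def)
qed

lemma time_deg_For: "time_deg (For x e c) = ecost_deg e + time_deg c + 18"
  by (simp add: For_def)

section \<open>Triples that record the exact output\<close>

definition triple :: "nat \<Rightarrow> (mem \<Rightarrow> bool) \<Rightarrow> com \<Rightarrow> nat list \<Rightarrow> (mem \<Rightarrow> bool) \<Rightarrow> bool" where
  "triple M A c ws B \<longleftrightarrow> (\<forall>s out. mem_le M s \<longrightarrow> A s \<longrightarrow>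
     wp M c (\<lambda>s' out'. B s' \<and> out' = out @ ws) s out)"

lemma triple_Skip: "triple M A Skip [] A"
  by (auto simp: triple_def intro: wp_Skip)

lemma triple_Assign:
  assumes "consts_le M e" "consts_le M f"
    and "\<And>s. mem_le M s \<Longrightarrow> A s \<Longrightarrow> val s f \<le> M \<and> B (s(a := (s a)(val s e := val s f)))"
  shows "triple M A (Assign a e f) [] B"
  using assms by (auto simp: triple_def intro!: wp_Assign)

lemma triple_Write:
  assumes "consts_le M e" "\<And>s. A s \<Longrightarrow> val s e = w"
  shows "triple M A (Write e) [w] A"
  using assms by (auto simp: triple_def intro!: wp_Write)

lemma triple_Seq:
  assumes "triple M A c ws B" "triple M B d vs C"
  shows "triple M A (Seq c d) (ws @ vs) C"
  unfolding triple_def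
proof (intro allI impI wp_Seq)
  fix s out assume "mem_le M s" "A s"
  then have "wp M c (\<lambda>s' out'. B s' \<and> out' = out @ ws) s out"
    using assms(1) by (simp add: triple_def)
  then show "wp M c (wp M d (\<lambda>s' out'. C s' \<and> out' = out @ ws @ vs)) s out"
  proof (rule wp_mono)
    fix s' out' assume "mem_le M s'" "B s' \<and> out' = out @ ws"
    then have "wp M d (\<lambda>s'' out''. C s'' \<and> out'' = out' @ vs) s' out'"
      using assms(2) unfolding triple_def by blast
    then show "wp M d (\<lambda>s'' out''. C s'' \<and> out'' = out @ ws @ vs) s' out'"
      by (rule wp_mono) (use \<open>B s' \<and> out' = out @ ws\<close> in simp)
  qed
qed

lemma triple_Seq_silent: "triple M A c [] B \<Longrightarrow> triple M B d vs C \<Longrightarrow> triple M A (Seq c d) vs C"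
  using triple_Seq[of M A c "[]"] by simp

lemma triple_Cond:
  assumes "consts_le M e" "\<And>s. A s \<Longrightarrow> val s e \<noteq> 0 \<longleftrightarrow> b"
    and "b \<Longrightarrow> triple M A c ws B" "\<not> b \<Longrightarrow> triple M A d ws B"
  shows "triple M A (Cond e c d) ws B"
  unfolding triple_def
proof (intro allI impI)
  fix s out assume s: "mem_le M s" "A s"
  show "wp M (Cond e c d) (\<lambda>s' out'. B s' \<and> out' = out @ ws) s out"
  proof (rule wp_Cond[OF s(1) assms(1)])
    assume "val s e \<noteq> 0"
    then have b using assms(2)[OF s(2)] by blast
    then show "wp M c (\<lambda>s' out'. B s' \<and> out' = out @ ws) s out"
      using assms(3) s unfolding triple_def by blast
  next
    assume "val s e = 0"
    then have "\<not> b" using assms(2)[OF s(2)] by blast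
    then show "wp M d (\<lambda>s' out'. B s' \<and> out' = out @ ws) s out"
      using assms(4) s unfolding triple_def by blast
  qed
qed

text \<open>A triple fixes its output in advance, but the output of a loop body depends on the
  counter. Freezing the counter array to a function \<open>h\<close> with \<open>h 0 = i\<close>
  turns the state-dependent output into \<open>ws i\<close>.\<close>

lemma triple_For:
  assumes "consts_le M e" "n \<le> M" "1 \<le> M"
    and "\<And>s. A s \<Longrightarrow> I 0 s \<and> val s e = n"
    and "\<And>i s f. I i s \<Longrightarrow> I i (s(x := f))"
    and "\<And>i h. i < n \<Longrightarrow> h 0 = i \<Longrightarrow>
      triple M (\<lambda>s. I i s \<and> s x = h) c (ws i) (\<lambda>s. I (Suc i) s \<and> s x = h)"
    and "\<And>s. I n s \<Longrightarrow> B s"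
  shows "triple M A (For x e c) (concat (map ws [0..<n])) B"
  unfolding triple_def
proof (intro allI impI)
  fix s out assume s: "mem_le M s" "A s"
  show "wp M (For x e c) (\<lambda>s' out'. B s' \<and> out' = out @ concat (map ws [0..<n])) s out"
  proof (rule wp_For[where I = "\<lambda>i s out'. I i s \<and> out' = out @ concat (map ws [0..<i])" and n = n])
    fix i s' out' assume i: "i < n" "mem_le M s'" "I i s' \<and> out' = out @ concat (map ws [0..<i])" "s' x 0 = i"
    have "wp M c (\<lambda>s'' out''. (I (Suc i) s'' \<and> s'' x = s' x) \<and> out'' = out' @ ws i) s' out'"
      using assms(6)[of i "s' x", OF i(1,4)] i(2) conjunct1[OF i(3)] by (simp add: triple_def)
    then show "wp M c (\<lambda>s'' out''. (I (Suc i) s'' \<and> out'' = out @ concat (map ws [0..<Suc i])) \<and> s'' x = s' x) s' out'"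
      by (rule wp_mono) (use i(3) in auto)
  qed (use s assms(1-3,7) assms(4)[OF s(2)] assms(5) in auto)
qed

lemma triple_For_silent:
  assumes "consts_le M e" "n \<le> M" "1 \<le> M"
    and "\<And>s. A s \<Longrightarrow> I 0 s \<and> val s e = n"
    and "\<And>i s f. I i s \<Longrightarrow> I i (s(x := f))"
    and "\<And>i h. i < n \<Longrightarrow> h 0 = i \<Longrightarrow>
      triple M (\<lambda>s. I i s \<and> s x = h) c [] (\<lambda>s. I (Suc i) s \<and> s x = h)"
    and "\<And>s. I n s \<Longrightarrow> B s"
  shows "triple M A (For x e c) [] B"
proof -
  have "concat (map (\<lambda>i. []) [0..<n]) = ([] :: nat list)" by (induction n) auto
  moreover have "triple M A (For x e c) (concat (map (\<lambda>i. []) [0..<n])) B"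
    by (rule triple_For[where I = I]) (fact assms)+
  ultimately show ?thesis by (simp only:)
qed

lemma triple_Seq_Write:
  assumes "consts_le M e" "\<And>s. A s \<Longrightarrow> val s e = w" "triple M A d vs B"
  shows "triple M A (Seq (Write e) d) (w # vs) B"
  using triple_Seq[OF triple_Write[OF assms(1,2)] assms(3)] by simp

lemma triple_mono:
  assumes "triple M A c ws B" "\<And>s. A' s \<Longrightarrow> A s" "\<And>s. B s \<Longrightarrow> B' s"
  shows "triple M A' c ws B'"
  unfolding triple_def
proof (intro allI impI)
  fix s out assume "mem_le M s" "A' s"
  then have "wp M c (\<lambda>s' out'. B s' \<and> out' = out @ ws) s out"
    using assms(1,2) by (simp add: triple_def)
  then show "wp M c (\<lambda>s' out'. B' s' \<and> out' = out @ ws) s out"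
    by (rule wp_mono) (use assms(3) in blast)
qed

section \<open>The instance\<close>

lemma wf_digraph_graph_of:
  assumes "\<And>u v w. (u, v, w) \<in> set (edges I) \<Longrightarrow> u < num_verts I \<and> v < num_verts I"
  shows "wf_digraph (graph_of I)"
  by standard (use assms in \<open>fastforce simp: graph_of_def\<close>)+

lemma graph_of_simps [simp]:
  "tail (graph_of I) (u, v, w) = u" "head (graph_of I) (u, v, w) = v"
  by (simp_all add: graph_of_def)

lemma arc_graph_of_iff:
  "(u, v, w) \<in> arcs (graph_of I) \<longleftrightarrow> (u, v, w) \<in> set (edges I) \<or> (v, u, w) \<in> set (edges I)"
  by (force simp: graph_of_def)

lemma reachable_edge:
  assumes "wf_digraph (graph_of I)" "(u, v, w) \<in> set (edges I)"
  shows "u \<rightarrow>\<^sup>*\<^bsub>graph_of I\<^esub> v" "v \<rightarrow>\<^sup>*\<^bsub>graph_of I\<^esub> u"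
proof -
  interpret wf_digraph "graph_of I" by fact
  have "(u, v, w) \<in> arcs (graph_of I)" "(v, u, w) \<in> arcs (graph_of I)"
    using assms(2) by (auto simp: arc_graph_of_iff)
  then have "arc_to_ends (graph_of I) (u, v, w) \<in> arcs_ends (graph_of I)"
    "arc_to_ends (graph_of I) (v, u, w) \<in> arcs_ends (graph_of I)"
    unfolding arcs_ends_def by blast+
  then show "u \<rightarrow>\<^sup>*\<^bsub>graph_of I\<^esub> v" "v \<rightarrow>\<^sup>*\<^bsub>graph_of I\<^esub> u"
    by (auto simp: arc_to_ends_def)
qed

lemma dst_le_edge:
  assumes "wf_digraph (graph_of I)" "(u, v, w) \<in> set (edges I)"
  shows "dst I v u \<le> ereal (real_of_rat w)"
proof -
  interpret wf_digraph "graph_of I" by fact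
  have "(v, u, w) \<in> arcs (graph_of I)" using assms(2) by (simp add: arc_graph_of_iff)
  from min_cost_le_walk_cost[OF arc_implies_awalk[OF this], of "\<lambda>(u, v, w). real_of_rat w"]
  show ?thesis by (simp add: dst_def)
qed

lemma dst_nonneg:
  assumes "wf_digraph (graph_of I)" "\<And>u v w. (u, v, w) \<in> set (edges I) \<Longrightarrow> 0 \<le> w"
  shows "0 \<le> dst I x y"
proof -
  interpret wf_digraph "graph_of I" by fact
  have "0 \<le> awalk_cost (\<lambda>(u, v, w). real_of_rat w) p" if "awalk x p y" for p
    using pos_cost_pos_awalk_cost[OF that] assms(2) by (fastforce simp: arc_graph_of_iff)
  then show ?thesis unfolding dst_def \<mu>_def by (auto intro: INF_greatest)
qed

text \<open>A walk that starts in \<open>R\<close> and ends outside has to use an arc across the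
  boundary. That arc alone costs \<open>W\<close>, and the other arcs cannot compensate, being
  nonnegative.\<close>

lemma dst_ge_cut:
  assumes "wf_digraph (graph_of I)" "x \<in> R" "y \<notin> R"
    and "\<And>u v w. (u, v, w) \<in> set (edges I) \<Longrightarrow> 0 \<le> w"
    and "\<And>u v w. (u, v, w) \<in> set (edges I) \<Longrightarrow> (u \<in> R) \<noteq> (v \<in> R) \<Longrightarrow> W \<le> real_of_rat w"
  shows "ereal W \<le> dst I x y"
proof -
  interpret wf_digraph "graph_of I" by fact
  let ?c = "\<lambda>(u, v, w). real_of_rat w"
  have nonneg: "0 \<le> ?c e" if "e \<in> arcs (graph_of I)" for e
    using that assms(4) by (cases e) (auto simp: arc_graph_of_iff)
  have "W \<le> awalk_cost ?c p" if "awalk x p y" "x \<in> R" for p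
    using that
  proof (induction p arbitrary: x)
    case Nil
    then show ?case using assms(3) by (simp add: awalk_Nil_iff)
  next
    case (Cons e p)
    obtain u v w where e: "e = (u, v, w)" by (cases e)
    have p: "e \<in> arcs (graph_of I)" "x = u" "awalk v p y"
      using Cons.prems(1) by (auto simp: awalk_Cons_iff e)
    have "0 \<le> awalk_cost ?c p" using pos_cost_pos_awalk_cost[OF p(3)] nonneg by blast
    moreover have "W \<le> ?c e" if "v \<notin> R"
      using p(1,2) Cons.prems(2) that assms(5) by (auto simp: e arc_graph_of_iff)
    moreover have "W \<le> awalk_cost ?c p" if "v \<in> R" using Cons.IH[OF p(3) that] .
    ultimately show ?case using nonneg[OF p(1)] by (cases "v \<in> R") auto
  qed
  then show ?thesis unfolding dst_def \<mu>_def using assms(2) by (auto intro: INF_greatest)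
qed

text \<open>Bounds the facility numbers b * \<kappa> + i and, applied twice, the group
  numbers.\<close>

lemma mult_add_less_mult:
  fixes n k :: nat
  assumes "v < n" "i < k"
  shows "v * k + i < n * k"
proof -
  have "v * k + i < (v + 1) * k" using assms(2) by simp
  also have "\<dots> \<le> n * k" using assms(1) by (intro mult_le_mono1) simp
  finally show ?thesis .
qed

fun lit_code :: "literal \<Rightarrow> nat" where
  "lit_code (Pos v) = 2 * v"
| "lit_code (Neg v) = 2 * v + 1"

definition code_at :: "cnf \<Rightarrow> nat \<Rightarrow> nat \<Rightarrow> nat" where
  "code_at \<phi> j l = lit_code (clauses \<phi> ! j ! l)"

text \<open>
  Clause \<open>j\<close> belongs to part \<open>j mod \<kappa>\<close>. Facility \<open>b * \<kappa> + i\<close> belongs to part \<open>i\<close>, and the \<open>b\<close>-th bit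
  string assigns a bit to every literal occurrence in that part, bit \<open>3 * (j div \<kappa>) + l\<close> to
  literal \<open>l\<close> of clause \<open>j\<close>. Entry \<open>v * \<kappa> + i\<close> of the table \<open>P\<close> is \<open>2\<^sup>s\<close> for one position \<open>s\<close> at which the
  variable \<open>v\<close> occurs in part \<open>i\<close>, and 0 if there is none. That bit is the value of \<open>v\<close>, encoded as
  2 for true, 1 for false and 0 for an absent variable. Group \<open>(v * \<kappa> + i) * \<kappa> + i'\<close> forbids that \<open>v\<close> is
  true in part \<open>i\<close> and false in part \<open>i'\<close>. The clients follow the facilities, and the last vertex is
  the hub. The empty group is there because a formula without variables yields no other group.
\<close>

definition value_at :: "nat \<Rightarrow> (nat \<Rightarrow> nat) \<Rightarrow> nat \<Rightarrow> nat \<Rightarrow> nat" where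
  "value_at \<kappa> P f v = (if P (v * \<kappa> + f mod \<kappa>) = 0 then 0
     else 1 + f div \<kappa> div P (v * \<kappa> + f mod \<kappa>) mod 2)"

text \<open>\<open>2 - code_at \<phi> j l mod 2\<close> is the value that makes the literal true: 2
  for an even code (positive), 1 for an odd one. An absent variable has value 0 and never matches.
  The literals are counted, not merely tested, because the program keeps a counter.\<close>

definition num_true :: "cnf \<Rightarrow> nat \<Rightarrow> (nat \<Rightarrow> nat) \<Rightarrow> nat \<Rightarrow> nat \<Rightarrow> nat \<Rightarrow> nat" where
  "num_true \<phi> \<kappa> P f j n =
     (\<Sum>l<n. of_bool (value_at \<kappa> P f (code_at \<phi> j l div 2) = 2 - code_at \<phi> j l mod 2))"

text \<open>Truncated subtraction makes \<open>1 - num_true\<close> the indicator of an unsatisfied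
  clause, and the factor in front masks the clauses of other parts, whose values do not concern
  \<open>f\<close>.\<close>

definition num_unsat :: "cnf \<Rightarrow> nat \<Rightarrow> (nat \<Rightarrow> nat) \<Rightarrow> nat \<Rightarrow> nat \<Rightarrow> nat" where
  "num_unsat \<phi> \<kappa> P f n = (\<Sum>j<n. of_bool (j mod \<kappa> = f mod \<kappa>) *
     (1 - num_true \<phi> \<kappa> P f j (length (clauses \<phi> ! j))))"

definition in_group :: "nat \<Rightarrow> (nat \<Rightarrow> nat) \<Rightarrow> nat \<Rightarrow> nat \<Rightarrow> bool" where
  "in_group \<kappa> P q f \<longleftrightarrow>
     f mod \<kappa> = q div \<kappa> mod \<kappa> \<and> value_at \<kappa> P f (q div \<kappa> div \<kappa>) = 2 \<or>
     f mod \<kappa> = q mod \<kappa> \<and> value_at \<kappa> P f (q div \<kappa> div \<kappa>) = 1"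

text \<open>An edge from a facility to its client has weight 1 if no clause of the part is violated,
  and more than \<open>W\<close> otherwise. The hub connects the parts, and its edges of weight
  \<open>W\<close> offer no cheap detour into another part.\<close>

definition gadget :: "cnf \<Rightarrow> nat \<Rightarrow> nat \<Rightarrow> nat \<Rightarrow> (nat \<Rightarrow> nat) \<Rightarrow> fr_instance" where
  "gadget \<phi> \<kappa> L W P = \<lparr>bound_k = \<kappa>, num_verts = \<kappa> * L + \<kappa> + 1,
     clients = map (\<lambda>i. \<kappa> * L + i) [0..<\<kappa>],
     facilities = [0..<\<kappa> * L],
     edges = map (\<lambda>f. (f, \<kappa> * L + f mod \<kappa>,
         of_nat (1 + num_unsat \<phi> \<kappa> P f (length (clauses \<phi>)) * W))) [0..<\<kappa> * L] @
       map (\<lambda>i. (\<kappa> * L + i, \<kappa> * L + \<kappa>, of_nat W)) [0..<\<kappa>],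
     groups = ([], 0, 0) #
       map (\<lambda>q. (filter (in_group \<kappa> P q) [0..<\<kappa> * L], 0, 1)) [0..<num_vars \<phi> * \<kappa> * \<kappa>]\<rparr>"

text \<open>A relation instead of a function: any recorded occurrence will do, so the program may
  overwrite entries in whatever order it meets the literals. The set \<open>J\<close> of occurrences
  seen so far makes it a loop invariant.\<close>

definition positions_of :: "cnf \<Rightarrow> nat \<Rightarrow> (nat \<times> nat) set \<Rightarrow> (nat \<Rightarrow> nat) \<Rightarrow> bool" where
  "positions_of \<phi> \<kappa> J P \<longleftrightarrow> (\<forall>v. \<forall>i<\<kappa>.
     P (v * \<kappa> + i) = 0 \<and> (\<forall>(j, l) \<in> J. j mod \<kappa> = i \<longrightarrow> code_at \<phi> j l div 2 \<noteq> v) \<or>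
     (\<exists>(j, l) \<in> J. j mod \<kappa> = i \<and> code_at \<phi> j l div 2 = v \<and>
        P (v * \<kappa> + i) = 2 ^ (3 * (j div \<kappa>) + l)))"

definition occurrences :: "cnf \<Rightarrow> (nat \<times> nat) set" where
  "occurrences \<phi> = {(j, l). j < length (clauses \<phi>) \<and> l < length (clauses \<phi> ! j)}"

section \<open>The gadget: admissibility, completeness and soundness\<close>

lemma num_true_pos_iff:
  "0 < num_true \<phi> \<kappa> P f j n \<longleftrightarrow>
    (\<exists>l<n. value_at \<kappa> P f (code_at \<phi> j l div 2) = 2 - code_at \<phi> j l mod 2)"
  by (auto simp: num_true_def zero_less_iff_neq_zero)

lemma num_unsat_eq_0_iff:
  "num_unsat \<phi> \<kappa> P f n = 0 \<longleftrightarrow> (\<forall>j<n. j mod \<kappa> = f mod \<kappa> \<longrightarrow>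
     0 < num_true \<phi> \<kappa> P f j (length (clauses \<phi> ! j)))"
  by (auto simp: num_unsat_def Suc_le_eq)

lemma gadget_simps [simp]:
  "bound_k (gadget \<phi> \<kappa> L W P) = \<kappa>"
  "num_verts (gadget \<phi> \<kappa> L W P) = \<kappa> * L + \<kappa> + 1"
  "set (clients (gadget \<phi> \<kappa> L W P)) = {\<kappa> * L..<\<kappa> * L + \<kappa>}"
  "facilities (gadget \<phi> \<kappa> L W P) = [0..<\<kappa> * L]"
  by (auto simp: gadget_def image_add_atLeastLessThan)

lemma edges_gadget:
  "(u, v, w) \<in> set (edges (gadget \<phi> \<kappa> L W P)) \<longleftrightarrow>
    u < \<kappa> * L \<and> v = \<kappa> * L + u mod \<kappa> \<and>
      w = of_nat (1 + num_unsat \<phi> \<kappa> P u (length (clauses \<phi>)) * W) \<or>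
    \<kappa> * L \<le> u \<and> u < \<kappa> * L + \<kappa> \<and> v = \<kappa> * L + \<kappa> \<and> w = of_nat W"
proof -
  have "(\<exists>i\<in>{0..<\<kappa>}. u = \<kappa> * L + i) \<longleftrightarrow> \<kappa> * L \<le> u \<and> u < \<kappa> * L + \<kappa>"
    by (auto intro: bexI[of _ "u - \<kappa> * L"])
  then show ?thesis by (auto simp: gadget_def image_iff)
qed

lemma wf_digraph_gadget:
  assumes "0 < \<kappa>"
  shows "wf_digraph (graph_of (gadget \<phi> \<kappa> L W P))"
  by (rule wf_digraph_graph_of) (use assms in \<open>auto simp: edges_gadget less_SucI\<close>)

text \<open>Each part is a star around its client and the clients form a star around the hub, so any
  two vertices are joined through the hub.\<close>

lemma fr_k_med_gadget:
  assumes "0 < \<kappa>" "0 < W"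
  shows "fr_k_med (gadget \<phi> \<kappa> L W P)"
proof -
  let ?I = "gadget \<phi> \<kappa> L W P" and ?h = "\<kappa> * L + \<kappa>"
  note wf = wf_digraph_gadget[OF assms(1), of \<phi> L W P]
  interpret wf_digraph "graph_of ?I" by (rule wf)
  have client: "x \<rightarrow>\<^sup>*\<^bsub>graph_of ?I\<^esub> ?h \<and> ?h \<rightarrow>\<^sup>*\<^bsub>graph_of ?I\<^esub> x" if "\<kappa> * L \<le> x" "x < \<kappa> * L + \<kappa>" for x
    using reachable_edge[OF wf, of x ?h "of_nat W"] that by (simp add: edges_gadget)
  have hub: "x \<rightarrow>\<^sup>*\<^bsub>graph_of ?I\<^esub> ?h \<and> ?h \<rightarrow>\<^sup>*\<^bsub>graph_of ?I\<^esub> x" if "x < \<kappa> * L + \<kappa>" for x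
  proof (cases "x < \<kappa> * L")
    case True
    let ?c = "\<kappa> * L + x mod \<kappa>"
    have "x \<rightarrow>\<^sup>*\<^bsub>graph_of ?I\<^esub> ?c \<and> ?c \<rightarrow>\<^sup>*\<^bsub>graph_of ?I\<^esub> x"
      using reachable_edge[OF wf] True by (metis edges_gadget)
    moreover have "?c \<rightarrow>\<^sup>*\<^bsub>graph_of ?I\<^esub> ?h \<and> ?h \<rightarrow>\<^sup>*\<^bsub>graph_of ?I\<^esub> ?c"
      by (rule client) (use assms(1) in auto)
    ultimately show ?thesis using reachable_trans by blast
  qed (use client that in auto)
  have "x \<rightarrow>\<^sup>*\<^bsub>graph_of ?I\<^esub> y" if "x < \<kappa> * L + \<kappa>" "y < \<kappa> * L + \<kappa>" for x y
    using hub[OF that(1)] hub[OF that(2)] reachable_trans by blast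
  moreover have "distinct (map (\<lambda>(u, v, w). (u, v)) (edges ?I))"
    by (auto simp: gadget_def distinct_map comp_def inj_on_def)
  moreover have "u < v \<and> v < num_verts ?I \<and> 0 < w" if "(u, v, w) \<in> set (edges ?I)" for u v w
  proof -
    have "u mod \<kappa> < \<kappa>" using assms(1) by simp
    then show ?thesis using that assms(2) by (auto simp: edges_gadget intro: add_pos_nonneg)
  qed
  moreover have "distinct (clients ?I)" by (simp add: gadget_def distinct_map)
  moreover have "groups ?I \<noteq> []" by (simp add: gadget_def)
  moreover have "distinct G \<and> \<alpha> \<le> \<beta>" if "(G, \<alpha>, \<beta>) \<in> set (groups ?I)" for G \<alpha> \<beta>
    using that by (auto simp: gadget_def)
  moreover have "x < \<kappa> * L" if "(G, \<alpha>, \<beta>) \<in> set (groups ?I)" "x \<in> set G" for G \<alpha> \<beta> x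
    using that by (auto simp: gadget_def)
  ultimately show ?thesis
    unfolding fr_k_med_def using assms(1) by auto
qed

lemma feasible_gadget_iff:
  "feasible (gadget \<phi> \<kappa> L W P) S \<longleftrightarrow> S \<subseteq> {0..<\<kappa> * L} \<and> card S \<le> \<kappa> \<and>
     (\<forall>q<num_vars \<phi> * \<kappa> * \<kappa>. card {f \<in> S. in_group \<kappa> P q f} \<le> 1)"
proof -
  have "S \<inter> {f. f < \<kappa> * L \<and> in_group \<kappa> P q f} = {f \<in> S. in_group \<kappa> P q f}"
    if "S \<subseteq> {0..<\<kappa> * L}" for q using that by auto
  then show ?thesis
    by (auto simp: feasible_def gadget_def)
qed

text \<open>Below \<kappa> all bits are 0, so no variable has value 2. Such a facility enters a
  group only through the second disjunct of \<open>in_group\<close>, which leaves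
  \<open>q mod \<kappa>\<close> as the sole candidate.\<close>

lemma feasible_gadget_initial:
  assumes "0 < \<kappa>" "0 < L"
  shows "feasible (gadget \<phi> \<kappa> L W P) {0..<\<kappa>}"
proof -
  have "{f \<in> {0..<\<kappa>}. in_group \<kappa> P q f} \<subseteq> {q mod \<kappa>}" for q
    by (auto simp: in_group_def value_at_def split: if_splits)
  then have "card {f \<in> {0..<\<kappa>}. in_group \<kappa> P q f} \<le> 1" for q
    using card_mono[of "{q mod \<kappa>}"] by fastforce
  moreover have "\<kappa> \<le> \<kappa> * L" using assms by simp
  ultimately show ?thesis by (auto simp: feasible_gadget_iff)
qed

lemma lit_code_div [simp]: "lit_code x div 2 = var_of x"
  by (cases x) auto

lemma value_eq_lit_iff:
  "(if \<sigma> (var_of x) then 2 else 1) = 2 - lit_code x mod 2 \<longleftrightarrow> lit_true \<sigma> x"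
  by (cases x) auto

text \<open>Each part chooses the string that copies \<sigma> to all its literal occurrences. The
  bits of a variable then agree, so it does not matter which occurrence \<open>P\<close> records,
  and the parts are consistent with each other.\<close>

lemma gadget_complete:
  assumes "0 < \<kappa>" "three_cnf \<phi>" "length (clauses \<phi>) \<le> g * \<kappa>"
    and P: "positions_of \<phi> \<kappa> (occurrences \<phi>) P"
    and sat: "num_sat \<sigma> \<phi> = length (clauses \<phi>)"
  shows "\<exists>S. feasible (gadget \<phi> \<kappa> (2 ^ (3 * g)) W P) S \<and>
    cost (gadget \<phi> \<kappa> (2 ^ (3 * g)) W P) S \<le> ereal (real \<kappa>)"
proof -
  \<comment> \<open>Inverts the position \<open>3 * (j div \<kappa>) + l\<close>. Positions without
    a literal get an unspecified bit, which is never read because \<open>P\<close> records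
    occurrences only.\<close>
  define bs where "bs i = map (\<lambda>s. \<sigma> (code_at \<phi> (s div 3 * \<kappa> + i) (s mod 3) div 2)) [0..<3 * g]" for i
  define b :: "nat \<Rightarrow> nat" where "b i = horner_sum of_bool 2 (bs i)" for i
  define F where "F i = b i * \<kappa> + i" for i
  define L :: nat where "L = 2 ^ (3 * g)"
  let ?I = "gadget \<phi> \<kappa> L W P"
  have b_less: "b i < L" for i
    using horner_sum_of_bool_2_less[of "bs i", where 'a = nat] by (simp add: b_def L_def bs_def)
  have F: "F i mod \<kappa> = i" "F i div \<kappa> = b i" "F i < \<kappa> * L" if "i < \<kappa>" for i
  proof -
    show "F i mod \<kappa> = i" using that by (auto simp: F_def)
    show "F i div \<kappa> = b i" using that by (auto simp: F_def)
    show "F i < \<kappa> * L"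
      using mult_add_less_mult[OF b_less that] by (simp add: F_def mult.commute)
  qed
  have short: "l < 3" if "(j, l) \<in> occurrences \<phi>" for j l
    using that assms(2) nth_mem by (fastforce simp: occurrences_def three_cnf_def)
  have bit: "b i div 2 ^ (3 * (j div \<kappa>) + l) mod 2 = of_bool (\<sigma> (code_at \<phi> j l div 2))"
    if "(j, l) \<in> occurrences \<phi>" "j mod \<kappa> = i" for i j l
  proof -
    let ?s = "3 * (j div \<kappa>) + l"
    have "j div \<kappa> < g" using that(1) assms(3) by (auto simp: occurrences_def intro: less_mult_imp_div_less)
    then have "?s < 3 * g" using short[OF that(1)] by linarith
    moreover have "?s div 3 = j div \<kappa>" "?s mod 3 = l" using short[OF that(1)] by auto
    moreover have "j div \<kappa> * \<kappa> + i = j" using that(2) by auto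
    ultimately have "bit (b i) ?s \<longleftrightarrow> \<sigma> (code_at \<phi> j l div 2)"
      by (simp add: b_def bit_horner_sum_bit_iff bs_def)
    then show ?thesis by (simp add: bit_iff_odd mod_2_eq_odd)
  qed
  have val: "value_at \<kappa> P (F i) v = 0 \<and> (\<forall>(j, l) \<in> occurrences \<phi>. j mod \<kappa> = i \<longrightarrow> code_at \<phi> j l div 2 \<noteq> v) \<or>
      value_at \<kappa> P (F i) v = (if \<sigma> v then 2 else 1)" if "i < \<kappa>" for i v
    using P[unfolded positions_of_def, rule_format, OF that, of v]
  proof
    assume "\<exists>(j, l)\<in>occurrences \<phi>. j mod \<kappa> = i \<and> code_at \<phi> j l div 2 = v \<and> P (v * \<kappa> + i) = 2 ^ (3 * (j div \<kappa>) + l)"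
    then show ?thesis using bit F[OF that] by (auto simp: value_at_def)
  qed (use F[OF that] in \<open>auto simp: value_at_def\<close>)
  have good: "num_unsat \<phi> \<kappa> P (F i) (length (clauses \<phi>)) = 0" if i: "i < \<kappa>" for i
    unfolding num_unsat_eq_0_iff
  proof (intro allI impI)
    fix j assume j: "j < length (clauses \<phi>)" "j mod \<kappa> = F i mod \<kappa>"
    have "filter (clause_sat \<sigma>) (clauses \<phi>) = clauses \<phi>"
      using sat unfolding num_sat_def by (metis length_filter_less less_irrefl filter_True)
    then have "clause_sat \<sigma> (clauses \<phi> ! j)" using j(1) by (metis filter_eq_ConsD filter_id_conv nth_mem)
    then obtain l where l: "l < length (clauses \<phi> ! j)" "lit_true \<sigma> (clauses \<phi> ! j ! l)"
      unfolding clause_sat_def by (metis in_set_conv_nth)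
    have "value_at \<kappa> P (F i) (code_at \<phi> j l div 2) = (if \<sigma> (code_at \<phi> j l div 2) then 2 else 1)"
      using val[OF i, of "code_at \<phi> j l div 2"] j F[OF i] l(1) by (auto simp: occurrences_def)
    then show "0 < num_true \<phi> \<kappa> P (F i) j (length (clauses \<phi> ! j))"
      unfolding num_true_pos_iff using l value_eq_lit_iff[of \<sigma> "clauses \<phi> ! j ! l"]
      by (auto simp: code_at_def)
  qed
  have "card {f \<in> F ` {0..<\<kappa>}. in_group \<kappa> P q f} \<le> 1" for q
  proof -
    let ?v = "q div \<kappa> div \<kappa>"
    \<comment> \<open>If \<sigma> makes the variable true, no chosen facility has value 1 for it,
      and only the choice of the first part of the group remains. If \<sigma> makes it false, only
      that of the second part does.\<close>
    have "{f \<in> F ` {0..<\<kappa>}. in_group \<kappa> P q f} \<subseteq> {F (if \<sigma> ?v then q div \<kappa> mod \<kappa> else q mod \<kappa>)}"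
    proof
      fix f assume "f \<in> {f \<in> F ` {0..<\<kappa>}. in_group \<kappa> P q f}"
      then obtain i where "i < \<kappa>" "f = F i" "in_group \<kappa> P q (F i)" by auto
      then show "f \<in> {F (if \<sigma> ?v then q div \<kappa> mod \<kappa> else q mod \<kappa>)}"
        using val[of i ?v] F[of i] by (auto simp: in_group_def split: if_splits)
    qed
    then show ?thesis using card_mono[of "{F (if \<sigma> ?v then q div \<kappa> mod \<kappa> else q mod \<kappa>)}"] by fastforce
  qed
  moreover have "card (F ` {0..<\<kappa>}) \<le> \<kappa>" using card_image_le[of "{0..<\<kappa>}" F] by simp
  ultimately have "feasible ?I (F ` {0..<\<kappa>})" using F(3) by (auto simp: feasible_gadget_iff)
  moreover have "cost ?I (F ` {0..<\<kappa>}) \<le> (\<Sum>c \<in> set (clients ?I). 1)"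
    unfolding cost_def
  proof (rule sum_mono)
    fix c assume "c \<in> set (clients ?I)"
    then obtain i where i: "i < \<kappa>" "c = \<kappa> * L + i" by simp (metis add_less_cancel_left le_Suc_ex)
    have "(F i, c, 1) \<in> set (edges ?I)" using F[OF i(1)] i good[OF i(1)] by (simp add: edges_gadget)
    from dst_le_edge[OF wf_digraph_gadget[OF assms(1)] this] have "dst ?I c (F i) \<le> 1"
      by (simp add: one_ereal_def)
    then show "(INF s \<in> F ` {0..<\<kappa>}. dst ?I c s) \<le> 1" using i(1) by (intro INF_lower2[of "F i"]) auto
  qed
  ultimately show ?thesis unfolding L_def by (auto simp: one_ereal_def)
qed

text \<open>Cut around the client together with the facilities joined to it by edges of weight 1.
  The edges that leave this set are the hub edge and the edges to facilities with a violated clause,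
  all of weight at least \<open>W\<close>.\<close>

lemma gadget_near:
  assumes "0 < \<kappa>" "i < \<kappa>" "f < \<kappa> * L"
    and "dst (gadget \<phi> \<kappa> L W P) (\<kappa> * L + i) f < ereal (real W)"
  shows "f mod \<kappa> = i \<and> num_unsat \<phi> \<kappa> P f (length (clauses \<phi>)) = 0"
proof (rule ccontr)
  assume far: "\<not> ?thesis"
  let ?I = "gadget \<phi> \<kappa> L W P"
  let ?R = "insert (\<kappa> * L + i) {f. f < \<kappa> * L \<and> f mod \<kappa> = i \<and>
    num_unsat \<phi> \<kappa> P f (length (clauses \<phi>)) = 0}"
  have "ereal (real W) \<le> dst ?I (\<kappa> * L + i) f"
  proof (rule dst_ge_cut[OF wf_digraph_gadget[OF assms(1)], where R = ?R])
    fix u v w assume "(u, v, w) \<in> set (edges ?I)" "(u \<in> ?R) \<noteq> (v \<in> ?R)"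
    moreover have "real W \<le> real_of_rat (of_nat (1 + k * W))" if "k \<noteq> 0" for k
    proof -
      have "W \<le> 1 + k * W" using that by (cases k) auto
      then show ?thesis unfolding of_rat_of_nat_eq by linarith
    qed
    ultimately show "real W \<le> real_of_rat w"
      using assms(2) by (auto simp: edges_gadget simp del: of_nat_add of_nat_mult)
  next
    fix u v w assume "(u, v, w) \<in> set (edges ?I)"
    then show "0 \<le> w" by (auto simp: edges_gadget)
  qed (use far assms(3) in auto)
  then show False using assms(4) by simp
qed

text \<open>Distances are nonnegative, so each client is nearer than \<open>W\<close> to some chosen
  facility, which by \<open>gadget_near\<close> lies in its part and violates no clause. The groups
  force these facilities to agree on every variable.\<close>

lemma gadget_sound:
  assumes "0 < \<kappa>" "three_cnf \<phi>"
    and feas: "feasible (gadget \<phi> \<kappa> L W P) S"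
    and cheap: "cost (gadget \<phi> \<kappa> L W P) S < ereal (real W)"
  shows "\<exists>\<sigma>. num_sat \<sigma> \<phi> = length (clauses \<phi>)"
proof -
  let ?I = "gadget \<phi> \<kappa> L W P"
  have S: "S \<subseteq> {0..<\<kappa> * L}" "\<And>q. q < num_vars \<phi> * \<kappa> * \<kappa> \<Longrightarrow> card {f \<in> S. in_group \<kappa> P q f} \<le> 1"
    using feas by (auto simp: feasible_gadget_iff)
  have nonneg: "0 \<le> dst ?I x y" for x y
    by (rule dst_nonneg[OF wf_digraph_gadget[OF assms(1)]]) (auto simp: edges_gadget)
  have "\<exists>f\<in>S. f mod \<kappa> = i \<and> num_unsat \<phi> \<kappa> P f (length (clauses \<phi>)) = 0" if i: "i < \<kappa>" for i
  proof -
    have "(INF s \<in> S. dst ?I (\<kappa> * L + i) s) \<le> cost ?I S"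
      unfolding cost_def
      using sum_mono2[of "set (clients ?I)" "{\<kappa> * L + i}" "\<lambda>c. INF s \<in> S. dst ?I c s"] i
      by (auto intro: INF_greatest nonneg)
    then have "(INF s \<in> S. dst ?I (\<kappa> * L + i) s) < ereal (real W)" using cheap by simp
    then obtain f where "f \<in> S" "dst ?I (\<kappa> * L + i) f < ereal (real W)" by (auto simp: INF_less_iff)
    moreover from this S(1) have "f < \<kappa> * L" by auto
    ultimately show ?thesis using gadget_near[OF assms(1) i, of f L \<phi> W P] by blast
  qed
  then obtain F where F: "\<And>i. i < \<kappa> \<Longrightarrow> F i \<in> S" "\<And>i. i < \<kappa> \<Longrightarrow> F i mod \<kappa> = i"
    "\<And>i. i < \<kappa> \<Longrightarrow> num_unsat \<phi> \<kappa> P (F i) (length (clauses \<phi>)) = 0" by metis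
  have consistent: False
    if "i < \<kappa>" "i' < \<kappa>" "v < num_vars \<phi>" "value_at \<kappa> P (F i) v = 2" "value_at \<kappa> P (F i') v = 1" for i i' v
  proof -
    let ?q = "(v * \<kappa> + i) * \<kappa> + i'"
    have q: "?q div \<kappa> = v * \<kappa> + i" "?q mod \<kappa> = i'" "(v * \<kappa> + i) div \<kappa> = v" "(v * \<kappa> + i) mod \<kappa> = i"
      using that by auto
    have "?q < num_vars \<phi> * \<kappa> * \<kappa>"
      using that(1-3) by (intro mult_add_less_mult)
    then have "card {f \<in> S. in_group \<kappa> P ?q f} \<le> 1" by (rule S(2))
    moreover have "{F i, F i'} \<subseteq> {f \<in> S. in_group \<kappa> P ?q f}"
      using that F by (auto simp: in_group_def q)
    moreover have "finite S" using S(1) finite_subset by blast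
    \<comment> \<open>This includes \<open>i = i'\<close>: one facility cannot give \<open>v\<close>
      both values.\<close>
    moreover have "F i \<noteq> F i'" using that(4,5) by auto
    ultimately show False using card_mono[of "{f \<in> S. in_group \<kappa> P ?q f}" "{F i, F i'}"] by simp
  qed
  \<comment> \<open>Negative literals hold because \<open>consistent\<close> excludes a part with
    value 2 once some part has value 1. Variables that no part makes true become false.\<close>
  define \<sigma> where "\<sigma> v \<longleftrightarrow> (\<exists>i<\<kappa>. value_at \<kappa> P (F i) v = 2)" for v
  have "clause_sat \<sigma> (clauses \<phi> ! j)" if j: "j < length (clauses \<phi>)" for j
  proof -
    define i where "i = j mod \<kappa>"
    have i: "i < \<kappa>" using assms(1) by (simp add: i_def)
    obtain l where l: "l < length (clauses \<phi> ! j)"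
      "value_at \<kappa> P (F i) (code_at \<phi> j l div 2) = 2 - code_at \<phi> j l mod 2"
      using F(2,3)[OF i] j by (auto simp: num_unsat_eq_0_iff num_true_pos_iff i_def)
    let ?x = "clauses \<phi> ! j ! l"
    have "var_of ?x < num_vars \<phi>" using assms(2) nth_mem[OF j] nth_mem[OF l(1)]
      by (auto simp: three_cnf_def)
    then have "lit_true \<sigma> ?x"
      using l(2) i consistent by (cases ?x) (auto simp: \<sigma>_def code_at_def)
    then show ?thesis using l(1) by (auto simp: clause_sat_def)
  qed
  then have "filter (clause_sat \<sigma>) (clauses \<phi>) = clauses \<phi>"
    by (auto simp: filter_id_conv in_set_conv_nth)
  then show ?thesis unfolding num_sat_def by metis
qed

section \<open>The reduction program\<close>

definition Var :: "nat \<Rightarrow> exp" where "Var x = Cell x (Const 0)"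
definition Mod :: "exp \<Rightarrow> exp \<Rightarrow> exp" where "Mod e f = Minus e (Times (Div e f) f)"
text \<open>The truncated differences in both directions add up to the absolute difference.\<close>

definition Eq :: "exp \<Rightarrow> exp \<Rightarrow> exp" where
  "Eq e f = Minus (Const 1) (Plus (Minus e f) (Minus f e))"

text \<open>The exponent will be \<open>D\<close>, which depends on p only, so the power can be
  unrolled into an expression instead of a loop.\<close>

primrec Power :: "exp \<Rightarrow> nat \<Rightarrow> exp" where
  "Power e 0 = Const 1"
| "Power e (Suc n) = Times e (Power e n)"

lemma val_macros [simp]:
  "val s (Var x) = s x 0"
  "val s (Mod e f) = val s e mod val s f"
  "val s (Eq e f) = of_bool (val s e = val s f)"
  "val s (Power e n) = val s e ^ n"
proof -
  show "val s (Power e n) = val s e ^ n" by (induction n) auto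
qed (auto simp: Var_def Mod_def Eq_def minus_div_mult_eq_mod)

lemma consts_le_macros [simp]:
  "consts_le M (Var x)"
  "consts_le M (Mod e f) \<longleftrightarrow> consts_le M e \<and> consts_le M f"
  "consts_le M (Eq e f) \<longleftrightarrow> 1 \<le> M \<and> consts_le M e \<and> consts_le M f"
  "1 \<le> M \<Longrightarrow> consts_le M e \<Longrightarrow> consts_le M (Power e n)"
proof -
  show "1 \<le> M \<Longrightarrow> consts_le M e \<Longrightarrow> consts_le M (Power e n)" by (induction n) auto
qed (auto simp: Var_def Mod_def Eq_def)

text \<open>The 3 skips the total length, the number of variables and the number of clauses.\<close>

definition clause_offset :: "cnf \<Rightarrow> nat \<Rightarrow> nat" where
  "clause_offset \<phi> j = 3 + (\<Sum>j'<j. 1 + length (clauses \<phi> ! j'))"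

lemma nth_concat_map:
  assumes "j < length xs" "l < length (f (xs ! j))"
  shows "(\<Sum>j'<j. length (f (xs ! j'))) + l < length (concat (map f xs)) \<and>
    concat (map f xs) ! ((\<Sum>j'<j. length (f (xs ! j'))) + l) = f (xs ! j) ! l"
  using assms
proof (induction xs arbitrary: j)
  case (Cons x xs)
  show ?case
  proof (cases j)
    case 0
    then show ?thesis using Cons.prems by (simp add: nth_append)
  next
    case (Suc j')
    then show ?thesis using Cons.IH[of j'] Cons.prems
      by (simp add: sum.lessThan_Suc_shift nth_append add.assoc del: sum.lessThan_Suc)
  qed
qed simp

lemma enc_literal_eq: "enc_literal x = [lit_code x]"
  by (cases x) auto

lemma enc_clause: "enc_list enc_literal c = length c # map lit_code c"
  by (induction c) (auto simp: enc_list_def enc_literal_eq)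

lemma input_mem_enc_cnf:
  "input_mem (enc_cnf \<phi>) 0 1 = num_vars \<phi>"
  "input_mem (enc_cnf \<phi>) 0 2 = length (clauses \<phi>)"
  by (simp_all add: input_mem_def enc_cnf_def enc_list_def numeral_2_eq_2)

lemma input_mem_clause:
  assumes "j < length (clauses \<phi>)"
  shows "input_mem (enc_cnf \<phi>) 0 (clause_offset \<phi> j) = length (clauses \<phi> ! j)"
    and "l < length (clauses \<phi> ! j) \<Longrightarrow>
      input_mem (enc_cnf \<phi>) 0 (clause_offset \<phi> j + 1 + l) = code_at \<phi> j l"
proof -
  let ?cs = "concat (map (enc_list enc_literal) (clauses \<phi>))"
  have xs: "enc_cnf \<phi> = num_vars \<phi> # length (clauses \<phi>) # ?cs"
    by (simp add: enc_cnf_def enc_list_def)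
  have *: "input_mem (enc_cnf \<phi>) 0 (clause_offset \<phi> j + l) = (enc_list enc_literal (clauses \<phi> ! j)) ! l"
    if "l < length (enc_list enc_literal (clauses \<phi> ! j))" for l
    using nth_concat_map[of j "clauses \<phi>" l "enc_list enc_literal"] assms that
    by (simp add: xs input_mem_def clause_offset_def enc_clause numeral_3_eq_3)
  show "input_mem (enc_cnf \<phi>) 0 (clause_offset \<phi> j) = length (clauses \<phi> ! j)"
    using *[of 0] by (simp add: enc_clause)
  show "input_mem (enc_cnf \<phi>) 0 (clause_offset \<phi> j + 1 + l) = code_at \<phi> j l"
    if "l < length (clauses \<phi> ! j)"
    using *[of "1 + l"] that by (simp add: enc_clause code_at_def)
qed

definition Nvars :: exp where "Nvars = Cell 0 (Const 1)"
definition Nclauses :: exp where "Nclauses = Cell 0 (Const 2)"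
definition Clen :: "exp \<Rightarrow> exp" where "Clen j = Cell 0 (Cell 1 j)"
definition Code :: "exp \<Rightarrow> exp \<Rightarrow> exp" where
  "Code j l = Cell 0 (Plus (Plus (Cell 1 j) (Const 1)) l)"
text \<open>Division rounded up, times three bits per clause: the length of the bit strings of a
  part.\<close>

definition Slots :: "nat \<Rightarrow> exp" where
  "Slots \<kappa> = Times (Const 3) (Div (Plus Nclauses (Const (\<kappa> - 1))) (Const \<kappa>))"

text \<open>
  Array 1 holds the positions of the clauses in the input, array 2 the powers of two, array 3 the
  table \<open>P\<close>, and array 4 the number \<open>L\<close> of facilities of a part. Arrays 5 to 7 are used by loops,
  arrays 8 and 9 by counters.
\<close>

definition Prepare :: "nat \<Rightarrow> com" where
  "Prepare \<kappa> =
    Seq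
      (Seq (Assign 1 (Const 0) (Const 3))
      (For 5 Nclauses
        (Assign 1 (Plus (Var 5) (Const 1)) (Plus (Plus (Cell 1 (Var 5)) (Const 1)) (Clen (Var 5))))))
    (Seq
      (Seq (Assign 2 (Const 0) (Const 1))
      (For 5 (Slots \<kappa>)
        (Assign 2 (Plus (Var 5) (Const 1)) (Times (Const 2) (Cell 2 (Var 5))))))
    (Seq (Assign 4 (Const 0) (Cell 2 (Slots \<kappa>)))
    (For 5 Nclauses (For 6 (Clen (Var 5))
      (Assign 3 (Plus (Times (Div (Code (Var 5) (Var 6)) (Const 2)) (Const \<kappa>)) (Mod (Var 5) (Const \<kappa>)))
        (Cell 2 (Plus (Times (Const 3) (Div (Var 5) (Const \<kappa>))) (Var 6))))))))"

text \<open>\<open>1 - (1 - p)\<close> is the indicator of \<open>p \<noteq> 0\<close>, so the case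
  distinction of \<open>value_at\<close> becomes a product. Division by \<open>p = 0\<close> is
  harmless in the other factor.\<close>

definition ValueAt :: "nat \<Rightarrow> exp \<Rightarrow> exp \<Rightarrow> exp" where
  "ValueAt \<kappa> f v = (let p = Cell 3 (Plus (Times v (Const \<kappa>)) (Mod f (Const \<kappa>))) in
     Times (Minus (Const 1) (Minus (Const 1) p))
       (Plus (Const 1) (Mod (Div (Div f (Const \<kappa>)) p) (Const 2))))"

definition InGroup :: "nat \<Rightarrow> exp \<Rightarrow> exp \<Rightarrow> exp" where
  "InGroup \<kappa> q f = (let v = ValueAt \<kappa> f (Div (Div q (Const \<kappa>)) (Const \<kappa>)) in Plus
     (Times (Eq (Mod f (Const \<kappa>)) (Mod (Div q (Const \<kappa>)) (Const \<kappa>))) (Eq v (Const 2)))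
     (Times (Eq (Mod f (Const \<kappa>)) (Mod q (Const \<kappa>))) (Eq v (Const 1))))"

definition Nfacilities :: "nat \<Rightarrow> exp" where "Nfacilities \<kappa> = Times (Const \<kappa>) (Var 4)"
definition Nverts :: "nat \<Rightarrow> exp" where
  "Nverts \<kappa> = Plus (Plus (Nfacilities \<kappa>) (Const \<kappa>)) (Const 1)"
text \<open>Exceeds p(n) * \<kappa> once p(x) \<le> D * x^D for x \<ge> 1; the last summand makes
  this strict. The weight is recomputed at every use and never stored, since cells must stay below
  \<open>M\<close>, which need not dominate it.\<close>

definition Weight :: "nat \<Rightarrow> nat \<Rightarrow> exp" where
  "Weight \<kappa> D = Plus (Times (Times (Const D) (Power (Nverts \<kappa>) D)) (Const \<kappa>)) (Const 1)"

definition CountUnsat :: "nat \<Rightarrow> com" where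
  "CountUnsat \<kappa> =
    Seq (Assign 9 (Const 0) (Const 0))
    (For 6 Nclauses
      (Seq (Assign 8 (Const 0) (Const 0))
      (Seq (For 7 (Clen (Var 6))
        (Assign 8 (Const 0) (Plus (Var 8)
          (Eq (ValueAt \<kappa> (Var 5) (Div (Code (Var 6) (Var 7)) (Const 2)))
            (Minus (Const 2) (Mod (Code (Var 6) (Var 7)) (Const 2)))))))
      (Assign 9 (Const 0) (Plus (Var 9)
        (Times (Eq (Mod (Var 6) (Const \<kappa>)) (Mod (Var 5) (Const \<kappa>))) (Minus (Const 1) (Var 8))))))))"

definition WriteEdges :: "nat \<Rightarrow> nat \<Rightarrow> com" where
  "WriteEdges \<kappa> D =
    Seq (Write (Plus (Nfacilities \<kappa>) (Const \<kappa>)))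
    (Seq (For 5 (Nfacilities \<kappa>)
      (Seq (CountUnsat \<kappa>)
      (Seq (Write (Var 5))
      (Seq (Write (Plus (Nfacilities \<kappa>) (Mod (Var 5) (Const \<kappa>))))
      (Seq (Write (Times (Const 2) (Plus (Const 1) (Times (Var 9) (Weight \<kappa> D)))))
      (Write (Const 2)))))))
    (For 5 (Const \<kappa>)
      (Seq (Write (Plus (Nfacilities \<kappa>) (Var 5)))
      (Seq (Write (Plus (Nfacilities \<kappa>) (Const \<kappa>)))
      (Seq (Write (Times (Const 2) (Weight \<kappa> D)))
      (Write (Const 2)))))))"

text \<open>The encoding puts the size of a group before its members, so the facilities are scanned
  twice. The three zeros are the empty group with its bounds; the bounds 0 and 1 of the other groups
  are encoded as 0 and 2.\<close>

definition WriteGroups :: "nat \<Rightarrow> com" where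
  "WriteGroups \<kappa> =
    Seq (Write (Plus (Const 1) (Times (Times Nvars (Const \<kappa>)) (Const \<kappa>))))
    (Seq (Write (Const 0)) (Seq (Write (Const 0)) (Seq (Write (Const 0))
    (For 5 (Times (Times Nvars (Const \<kappa>)) (Const \<kappa>))
      (Seq (Assign 8 (Const 0) (Const 0))
      (Seq (For 6 (Nfacilities \<kappa>) (Assign 8 (Const 0) (Plus (Var 8) (InGroup \<kappa> (Var 5) (Var 6)))))
      (Seq (Write (Var 8))
      (Seq (For 6 (Nfacilities \<kappa>) (Cond (InGroup \<kappa> (Var 5) (Var 6)) (Write (Var 6)) Skip))
      (Seq (Write (Const 0)) (Write (Const 2)))))))))))"

definition Reduction :: "nat \<Rightarrow> nat \<Rightarrow> com" where
  "Reduction \<kappa> D =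
    Seq (Prepare \<kappa>)
    (Seq (Write (Const \<kappa>))
    (Seq (Write (Nverts \<kappa>))
    (Seq (Write (Const \<kappa>))
    (Seq (For 5 (Const \<kappa>) (Write (Plus (Nfacilities \<kappa>) (Var 5))))
    (Seq (Write (Nfacilities \<kappa>))
    (Seq (For 5 (Nfacilities \<kappa>) (Write (Var 5)))
    (Seq (WriteEdges \<kappa> D) (WriteGroups \<kappa>))))))))"

lemma val_ValueAt [simp]: "val s (ValueAt \<kappa> f v) = value_at \<kappa> (s 3) (val s f) (val s v)"
  by (auto simp: ValueAt_def value_at_def Let_def)

text \<open>The two summands are never both 1, because a value is not both 2 and 1. Hence the sum is
  a truth value that can be added to a counter.\<close>

lemma val_InGroup [simp]: "val s (InGroup \<kappa> q f) = of_bool (in_group \<kappa> (s 3) (val s q) (val s f))"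
  by (auto simp: InGroup_def in_group_def Let_def)

lemma consts_le_reduction [simp]:
  "2 \<le> M \<Longrightarrow> consts_le M Nvars"
  "2 \<le> M \<Longrightarrow> consts_le M Nclauses"
  "2 \<le> M \<Longrightarrow> consts_le M j \<Longrightarrow> consts_le M (Clen j)"
  "2 \<le> M \<Longrightarrow> consts_le M j \<Longrightarrow> consts_le M l \<Longrightarrow> consts_le M (Code j l)"
  "3 \<le> M \<Longrightarrow> \<kappa> \<le> M \<Longrightarrow> consts_le M (Slots \<kappa>)"
  "2 \<le> M \<Longrightarrow> \<kappa> \<le> M \<Longrightarrow> consts_le M f \<Longrightarrow> consts_le M v \<Longrightarrow> consts_le M (ValueAt \<kappa> f v)"
  "2 \<le> M \<Longrightarrow> \<kappa> \<le> M \<Longrightarrow> consts_le M q \<Longrightarrow> consts_le M f \<Longrightarrow> consts_le M (InGroup \<kappa> q f)"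
  "\<kappa> \<le> M \<Longrightarrow> consts_le M (Nfacilities \<kappa>)"
  "1 \<le> M \<Longrightarrow> \<kappa> \<le> M \<Longrightarrow> consts_le M (Nverts \<kappa>)"
  "1 \<le> M \<Longrightarrow> \<kappa> \<le> M \<Longrightarrow> D \<le> M \<Longrightarrow> consts_le M (Weight \<kappa> D)"
  by (auto simp: Nvars_def Nclauses_def Clen_def Code_def Slots_def ValueAt_def InGroup_def Let_def
      Nfacilities_def Nverts_def Weight_def)

text \<open>\<open>int_encode\<close> doubles nonnegative integers, the denominator 1 included. This
  explains the doubled weights and the trailing 2 in \<open>WriteEdges\<close>.\<close>

lemma enc_rat_of_nat: "enc_rat (of_nat n) = [2 * n, 2]"
proof -
  have "quotient_of (of_nat n) = (int n, 1)"
    using quotient_of_int[of "int n"] by (simp add: Rat.of_int_def)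
  then show ?thesis by (simp add: enc_rat_def int_encode_def sum_encode_def)
qed

text \<open>The concatenations follow the loops of the program, so that the output lists of the
  triples match them literally.\<close>

lemma enc_instance_gadget:
  "enc_instance (gadget \<phi> \<kappa> L W P) =
    \<kappa> # (\<kappa> * L + \<kappa> + 1) #
    \<kappa> # concat (map (\<lambda>i. [\<kappa> * L + i]) [0..<\<kappa>]) @
    (\<kappa> * L) # concat (map (\<lambda>f. [f]) [0..<\<kappa> * L]) @
    ((\<kappa> * L + \<kappa>) # concat (map (\<lambda>f. [f, \<kappa> * L + f mod \<kappa>,
        2 * (1 + num_unsat \<phi> \<kappa> P f (length (clauses \<phi>)) * W), 2]) [0..<\<kappa> * L]) @
      concat (map (\<lambda>i. [\<kappa> * L + i, \<kappa> * L + \<kappa>, 2 * W, 2]) [0..<\<kappa>])) @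
    (1 + num_vars \<phi> * \<kappa> * \<kappa>) # 0 # 0 # 0 # concat (map (\<lambda>q.
      length (filter (in_group \<kappa> P q) [0..<\<kappa> * L]) #
      concat (map (\<lambda>f. if in_group \<kappa> P q f then [f] else []) [0..<\<kappa> * L]) @ [0, 2])
      [0..<num_vars \<phi> * \<kappa> * \<kappa>])"
proof -
  have "concat (map (\<lambda>f. if p f then [f] else []) xs) = filter p xs" for p and xs :: "nat list"
    by (induction xs) auto
  moreover have "int_encode 0 = 0" "int_encode 1 = 2"
    by (simp_all add: int_encode_def sum_encode_def)
  ultimately show ?thesis
    by (simp add: enc_instance_def gadget_def enc_list_def comp_def enc_rat_of_nat
        del: of_nat_add of_nat_mult of_nat_Suc)
qed

section \<open>Degrees under a change of constants\<close>

definition same_deg :: "exp \<Rightarrow> exp \<Rightarrow> bool" where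
  "same_deg e e' \<longleftrightarrow> val_deg e = val_deg e' \<and> ecost_deg e = ecost_deg e'"

lemma same_deg_intros:
  "same_deg e e"
  "same_deg (Const n) (Const n')"
  "same_deg e e' \<Longrightarrow> same_deg (Cell a e) (Cell a e')"
  "same_deg e e' \<Longrightarrow> same_deg f f' \<Longrightarrow> same_deg (Plus e f) (Plus e' f')"
  "same_deg e e' \<Longrightarrow> same_deg f f' \<Longrightarrow> same_deg (Minus e f) (Minus e' f')"
  "same_deg e e' \<Longrightarrow> same_deg f f' \<Longrightarrow> same_deg (Times e f) (Times e' f')"
  "same_deg e e' \<Longrightarrow> same_deg f f' \<Longrightarrow> same_deg (Div e f) (Div e' f')"
  by (auto simp: same_deg_def)

lemma same_deg_macros:
  "same_deg e e' \<Longrightarrow> same_deg f f' \<Longrightarrow> same_deg (Mod e f) (Mod e' f')"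
  "same_deg e e' \<Longrightarrow> same_deg f f' \<Longrightarrow> same_deg (Eq e f) (Eq e' f')"
  "same_deg e e' \<Longrightarrow> same_deg (Power e n) (Power e' n)"
proof -
  show "same_deg e e' \<Longrightarrow> same_deg (Power e n) (Power e' n)"
    by (induction n) (auto intro: same_deg_intros)
qed (auto simp: Mod_def Eq_def intro!: same_deg_intros)

lemma same_deg_reduction:
  "same_deg (Slots \<kappa>) (Slots \<kappa>')"
  "same_deg (ValueAt \<kappa> f v) (ValueAt \<kappa>' f v)"
  "same_deg (Nfacilities \<kappa>) (Nfacilities \<kappa>')"
  "same_deg (Nverts \<kappa>) (Nverts \<kappa>')"
  "same_deg (Weight \<kappa> D) (Weight \<kappa>' D)"
  "same_deg (InGroup \<kappa> q f) (InGroup \<kappa>' q f)"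
  unfolding Slots_def ValueAt_def Nfacilities_def Nverts_def Weight_def InGroup_def Let_def
  by (intro same_deg_intros(2-) same_deg_macros same_deg_intros(1))+

lemma time_deg_cong:
  "same_deg e e' \<Longrightarrow> same_deg f f' \<Longrightarrow> time_deg (Assign a e f) = time_deg (Assign a e' f')"
  "same_deg e e' \<Longrightarrow> time_deg (Write e) = time_deg (Write e')"
  "time_deg c = time_deg c' \<Longrightarrow> time_deg d = time_deg d' \<Longrightarrow> time_deg (Seq c d) = time_deg (Seq c' d')"
  "same_deg e e' \<Longrightarrow> time_deg c = time_deg c' \<Longrightarrow> time_deg d = time_deg d' \<Longrightarrow>
    time_deg (Cond e c d) = time_deg (Cond e' c' d')"
  "same_deg e e' \<Longrightarrow> time_deg c = time_deg c' \<Longrightarrow> time_deg (For x e c) = time_deg (For x e' c')"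
  by (simp_all add: same_deg_def time_deg_For)

text \<open>The exponent in the time bound does not depend on \<open>\<kappa>\<close>, which occurs only in constants.\<close>

lemma time_deg_Reduction: "time_deg (Reduction \<kappa> D) = time_deg (Reduction \<kappa>' D)"
  unfolding Reduction_def Prepare_def CountUnsat_def WriteEdges_def WriteGroups_def
  by (intro time_deg_cong same_deg_reduction same_deg_macros same_deg_intros refl)

section \<open>Correctness of the reduction program\<close>

locale reduction_run =
  fixes \<phi> :: cnf and \<kappa> D M :: nat
  assumes kappa: "0 < \<kappa>" and three: "three_cnf \<phi>"
    and bound: "4 * length (clauses \<phi>) + 2 * num_vars \<phi> + num_vars \<phi> * \<kappa> * \<kappa> + \<kappa> + D + 4
      + \<kappa> * 2 ^ (3 * ((length (clauses \<phi>) + (\<kappa> - 1)) div \<kappa>)) \<le> M"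
begin

definition m where "m = length (clauses \<phi>)"
definition g where "g = (m + (\<kappa> - 1)) div \<kappa>"
definition L :: nat where "L = 2 ^ (3 * g)"
definition clen where "clen j = length (clauses \<phi> ! j)"
definition mem0 where "mem0 = input_mem (enc_cnf \<phi>) 0"

text \<open>These cover what is stored or used as a loop bound: clause positions up to 4 m + 3,
  literal codes below 2 n', the group numbers, the \<kappa> L facilities. The string length
  \<open>3 * g\<close> is below \<open>L = 2 ^ (3 * g)\<close>.\<close>

lemma M_bounds:
  "4 * m + 3 \<le> M" "m \<le> M" "2 * num_vars \<phi> + 1 \<le> M" "num_vars \<phi> * \<kappa> * \<kappa> \<le> M" "\<kappa> \<le> M" "D \<le> M"
  "4 \<le> M" "3 \<le> M" "2 \<le> M" "1 \<le> M" "Suc 0 \<le> M" "\<kappa> * L \<le> M" "L \<le> M" "3 * g \<le> M" "0 < M"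
proof -
  show *: "\<kappa> * L \<le> M" using bound by (simp add: L_def g_def m_def)
  have "L \<le> \<kappa> * L" using kappa by simp
  from order_trans[OF this *] show "L \<le> M" .
  moreover have "3 * g < L" unfolding L_def by (rule less_exp)
  ultimately show "3 * g \<le> M" by simp
qed (use bound in \<open>auto simp: m_def\<close>)

lemma clen_le: "j < m \<Longrightarrow> clen j \<le> 3"
  using three by (auto simp: three_cnf_def clen_def m_def)

lemma sum_clen_le: "j \<le> m \<Longrightarrow> (\<Sum>j'<j. 1 + clen j') \<le> 4 * j"
proof (induction j)
  case (Suc j)
  then show ?case using clen_le[of j] by simp
qed simp

lemma clause_offset_le: "j \<le> m \<Longrightarrow> clause_offset \<phi> j \<le> M"
  using sum_clen_le[of j] M_bounds(1) by (simp add: clause_offset_def clen_def)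

lemma mem0_simps [simp]:
  "mem0 (Suc 0) = num_vars \<phi>" "mem0 2 = m"
  "j < m \<Longrightarrow> mem0 (clause_offset \<phi> j) = clen j"
  "j < m \<Longrightarrow> l < clen j \<Longrightarrow> mem0 (Suc (clause_offset \<phi> j + l)) = code_at \<phi> j l"
  using input_mem_enc_cnf[of \<phi>] input_mem_clause[of j \<phi>] by (auto simp: mem0_def m_def clen_def)

lemma mem_le_input: "mem_le M (input_mem (enc_cnf \<phi>))"
proof -
  have lits: "length (concat (map (enc_list enc_literal) (clauses \<phi>))) = (\<Sum>j'<m. 1 + clen j')"
    by (simp add: length_concat comp_def enc_clause sum_list_sum_nth m_def clen_def atLeast0LessThan)
  then have len: "length (enc_cnf \<phi>) \<le> M"
    using sum_clen_le[of m] M_bounds(1) by (simp add: enc_cnf_def enc_list_def)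
  have "lit_code x \<le> M" if "x \<in> set c" "c \<in> set (clauses \<phi>)" for x c
  proof -
    have "var_of x < num_vars \<phi>" using three that by (auto simp: three_cnf_def)
    then show ?thesis using M_bounds(3) by (cases x) auto
  qed
  moreover have "length c \<le> M" if "c \<in> set (clauses \<phi>)" for c
    using three that M_bounds(8) by (force simp: three_cnf_def)
  ultimately have "x \<le> M" if "x \<in> set (enc_cnf \<phi>)" for x
    using that M_bounds by (auto simp: enc_cnf_def enc_list_def enc_literal_eq m_def)
  then have all: "x \<le> M" if "x \<in> set (length (enc_cnf \<phi>) # enc_cnf \<phi>)" for x
    using that len by auto
  have "(length (enc_cnf \<phi>) # enc_cnf \<phi>) ! i \<le> M" if "i \<le> length (enc_cnf \<phi>)" for i
    by (rule all, rule nth_mem) (use that in simp)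
  then show ?thesis unfolding mem_le_def input_mem_def by simp
qed

text \<open>The zeros of array 3 are carried along as the empty table, with which
  \<open>positions_of\<close> starts at \<open>J = {}\<close>.\<close>

definition offsets_ready where
  "offsets_ready j s \<longleftrightarrow> s 0 = mem0 \<and> s 3 = (\<lambda>_. 0) \<and> (\<forall>j'\<le>j. s 1 j' = clause_offset \<phi> j')"

definition powers_ready where
  "powers_ready i s \<longleftrightarrow> offsets_ready m s \<and> (\<forall>i'\<le>i. s 2 i' = 2 ^ i')"

definition positions_ready where
  "positions_ready J s \<longleftrightarrow> s 0 = mem0 \<and> (\<forall>j\<le>m. s 1 j = clause_offset \<phi> j) \<and>
     (\<forall>i\<le>3 * g. s 2 i = 2 ^ i) \<and> s 4 0 = L \<and> positions_of \<phi> \<kappa> J (s 3)"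

text \<open>What the output phase reads. It speaks of arrays 0, 1, 3 and 4 only, and that phase
  writes to arrays from 5 on, so \<open>ready\<close> survives each of its assignments.\<close>

definition ready where
  "ready P s \<longleftrightarrow> s 0 = mem0 \<and> (\<forall>j<m. s 1 j = clause_offset \<phi> j) \<and> s 3 = P \<and> s 4 0 = L"

lemma triple_offsets:
  "triple M (\<lambda>s. s = input_mem (enc_cnf \<phi>))
    (Seq (Assign 1 (Const 0) (Const 3)) (For 5 Nclauses
      (Assign 1 (Plus (Var 5) (Const 1)) (Plus (Plus (Cell 1 (Var 5)) (Const 1)) (Clen (Var 5))))))
    [] (offsets_ready m)"
proof (rule triple_Seq_silent)
  show "triple M (\<lambda>s. s = input_mem (enc_cnf \<phi>)) (Assign 1 (Const 0) (Const 3)) [] (offsets_ready 0)"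
    by (rule triple_Assign)
      (use M_bounds in \<open>auto simp: offsets_ready_def mem0_def clause_offset_def input_mem_def fun_eq_iff\<close>)
  show "triple M (offsets_ready 0) (For 5 Nclauses
      (Assign 1 (Plus (Var 5) (Const 1)) (Plus (Plus (Cell 1 (Var 5)) (Const 1)) (Clen (Var 5)))))
    [] (offsets_ready m)"
  proof (rule triple_For_silent[where I = offsets_ready and n = m])
    fix i :: nat and h :: "nat \<Rightarrow> nat" assume i: "i < m" "h 0 = i"
    have off: "clause_offset \<phi> (Suc i) = clause_offset \<phi> i + 1 + clen i"
      by (simp add: clause_offset_def clen_def)
    show "triple M (\<lambda>s. offsets_ready i s \<and> s 5 = h)
      (Assign 1 (Plus (Var 5) (Const 1)) (Plus (Plus (Cell 1 (Var 5)) (Const 1)) (Clen (Var 5))))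
      [] (\<lambda>s. offsets_ready (Suc i) s \<and> s 5 = h)"
      by (rule triple_Assign)
        (use i M_bounds off clause_offset_le[of "Suc i"] in
          \<open>auto simp: offsets_ready_def Clen_def le_Suc_eq\<close>)
  qed (use M_bounds in \<open>auto simp: offsets_ready_def Nclauses_def\<close>)
qed

lemma val_Slots: "s 0 = mem0 \<Longrightarrow> val s (Slots \<kappa>) = 3 * g"
  by (simp add: Slots_def Nclauses_def g_def)

lemma triple_powers:
  "triple M (offsets_ready m)
    (Seq (Assign 2 (Const 0) (Const 1)) (For 5 (Slots \<kappa>)
      (Assign 2 (Plus (Var 5) (Const 1)) (Times (Const 2) (Cell 2 (Var 5))))))
    [] (powers_ready (3 * g))"
proof (rule triple_Seq_silent)
  show "triple M (offsets_ready m) (Assign 2 (Const 0) (Const 1)) [] (powers_ready 0)"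
    by (rule triple_Assign) (use M_bounds in \<open>auto simp: offsets_ready_def powers_ready_def\<close>)
  show "triple M (powers_ready 0) (For 5 (Slots \<kappa>)
      (Assign 2 (Plus (Var 5) (Const 1)) (Times (Const 2) (Cell 2 (Var 5)))))
    [] (powers_ready (3 * g))"
  proof (rule triple_For_silent[where I = powers_ready and n = "3 * g"])
    fix i :: nat and h :: "nat \<Rightarrow> nat" assume i: "i < 3 * g" "h 0 = i"
    have "(2 :: nat) ^ Suc i \<le> L" unfolding L_def using i(1) by (intro power_increasing) auto
    then have "2 * 2 ^ i \<le> M" using M_bounds by simp
    then show "triple M (\<lambda>s. powers_ready i s \<and> s 5 = h)
      (Assign 2 (Plus (Var 5) (Const 1)) (Times (Const 2) (Cell 2 (Var 5))))
      [] (\<lambda>s. powers_ready (Suc i) s \<and> s 5 = h)"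
      by (intro triple_Assign)
        (use i M_bounds in \<open>auto simp: powers_ready_def offsets_ready_def le_Suc_eq\<close>)
  qed (use M_bounds in \<open>auto simp: powers_ready_def offsets_ready_def val_Slots\<close>)
qed

lemma clauses_le: "m \<le> g * \<kappa>"
proof -
  have "m + (\<kappa> - 1) = g * \<kappa> + (m + (\<kappa> - 1)) mod \<kappa>" by (simp add: g_def)
  moreover have "(m + (\<kappa> - 1)) mod \<kappa> \<le> \<kappa> - 1" using kappa by (simp add: Suc_leI less_Suc_eq_le[symmetric])
  ultimately show ?thesis by linarith
qed

lemma slot_less:
  assumes "j < m" "l < clen j"
  shows "3 * (j div \<kappa>) + l < 3 * g"
proof -
  have "j div \<kappa> < g" using assms(1) clauses_le by (intro less_mult_imp_div_less) simp
  then show ?thesis using assms clen_le[of j] by linarith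
qed

text \<open>The new occurrence is a valid witness for the changed entry, whatever stood there. All
  other entries keep theirs, since v * \<kappa> + i determines v and i < \<kappa>.\<close>

lemma positions_of_insert:
  assumes "positions_of \<phi> \<kappa> J P"
  shows "positions_of \<phi> \<kappa> (insert (j, l) J)
    (P(code_at \<phi> j l div 2 * \<kappa> + j mod \<kappa> := 2 ^ (3 * (j div \<kappa>) + l)))"
  unfolding positions_of_def
proof (intro allI impI)
  fix v i assume i: "i < \<kappa>"
  have eq: "v * \<kappa> + i = code_at \<phi> j l div 2 * \<kappa> + j mod \<kappa> \<longleftrightarrow> v = code_at \<phi> j l div 2 \<and> i = j mod \<kappa>"
    (is "?a = ?b \<longleftrightarrow> _")
  proof
    assume "?a = ?b"
    then have "?a div \<kappa> = ?b div \<kappa>" "?a mod \<kappa> = ?b mod \<kappa>" by simp_all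
    then show "v = code_at \<phi> j l div 2 \<and> i = j mod \<kappa>" using i kappa by simp
  qed simp
  show "(P(?b := 2 ^ (3 * (j div \<kappa>) + l))) ?a = 0 \<and>
      (\<forall>(j', l') \<in> insert (j, l) J. j' mod \<kappa> = i \<longrightarrow> code_at \<phi> j' l' div 2 \<noteq> v) \<or>
    (\<exists>(j', l') \<in> insert (j, l) J. j' mod \<kappa> = i \<and> code_at \<phi> j' l' div 2 = v \<and>
      (P(?b := 2 ^ (3 * (j div \<kappa>) + l))) ?a = 2 ^ (3 * (j' div \<kappa>) + l'))"
  proof (cases "?a = ?b")
    case True
    then show ?thesis using eq by auto
  next
    case False
    with assms[unfolded positions_of_def, rule_format, OF i, of v] eq show ?thesis by auto
  qed
qed

lemma triple_positions:
  "triple M (positions_ready {})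
    (For 5 Nclauses (For 6 (Clen (Var 5))
      (Assign 3 (Plus (Times (Div (Code (Var 5) (Var 6)) (Const 2)) (Const \<kappa>)) (Mod (Var 5) (Const \<kappa>)))
        (Cell 2 (Plus (Times (Const 3) (Div (Var 5) (Const \<kappa>))) (Var 6))))))
    [] (positions_ready (occurrences \<phi>))"
proof (rule triple_For_silent[where n = m and I = "\<lambda>j. positions_ready {(j', l). j' < j \<and> l < clen j'}"])
  fix j :: nat and h :: "nat \<Rightarrow> nat" assume j: "j < m" "h 0 = j"
  let ?J = "\<lambda>l. {(j', l'). j' < j \<and> l' < clen j'} \<union> {j} \<times> {..<l}"
  show "triple M (\<lambda>s. positions_ready {(j', l). j' < j \<and> l < clen j'} s \<and> s 5 = h)
    (For 6 (Clen (Var 5))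
      (Assign 3 (Plus (Times (Div (Code (Var 5) (Var 6)) (Const 2)) (Const \<kappa>)) (Mod (Var 5) (Const \<kappa>)))
        (Cell 2 (Plus (Times (Const 3) (Div (Var 5) (Const \<kappa>))) (Var 6)))))
    [] (\<lambda>s. positions_ready {(j', l). j' < Suc j \<and> l < clen j'} s \<and> s 5 = h)"
  proof (rule triple_For_silent[where n = "clen j" and I = "\<lambda>l s. positions_ready (?J l) s \<and> s 5 = h"])
    fix l :: nat and h' :: "nat \<Rightarrow> nat" assume l: "l < clen j" "h' 0 = l"
    have "(2 :: nat) ^ (3 * (j div \<kappa>) + l) \<le> L"
      unfolding L_def using slot_less[OF j(1) l(1)] by (intro power_increasing) auto
    then have le: "2 ^ (3 * (j div \<kappa>) + l) \<le> M" using M_bounds by simp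
    have "?J (Suc l) = insert (j, l) (?J l)" by auto
    then show "triple M (\<lambda>s. (positions_ready (?J l) s \<and> s 5 = h) \<and> s 6 = h')
      (Assign 3 (Plus (Times (Div (Code (Var 5) (Var 6)) (Const 2)) (Const \<kappa>)) (Mod (Var 5) (Const \<kappa>)))
        (Cell 2 (Plus (Times (Const 3) (Div (Var 5) (Const \<kappa>))) (Var 6))))
      [] (\<lambda>s. (positions_ready (?J (Suc l)) s \<and> s 5 = h) \<and> s 6 = h')"
      using j l le M_bounds slot_less[OF j(1) l(1)]
      by (intro triple_Assign)
        (auto simp: positions_ready_def Code_def intro!: positions_of_insert)
  next
    fix s assume "positions_ready (?J (clen j)) s \<and> s 5 = h"
    moreover have "?J (clen j) = {(j', l). j' < Suc j \<and> l < clen j'}" by (auto simp: less_Suc_eq)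
    ultimately show "positions_ready {(j', l). j' < Suc j \<and> l < clen j'} s \<and> s 5 = h" by simp
  qed (use j clen_le[of j] M_bounds in \<open>auto simp: positions_ready_def Clen_def\<close>)
next
  fix s assume "positions_ready {(j', l). j' < m \<and> l < clen j'} s"
  then show "positions_ready (occurrences \<phi>) s" by (simp add: occurrences_def m_def clen_def)
qed (use M_bounds in \<open>auto simp: positions_ready_def Nclauses_def\<close>)

lemma triple_Prepare:
  "triple M (\<lambda>s. s = input_mem (enc_cnf \<phi>)) (Prepare \<kappa>) [] (positions_ready (occurrences \<phi>))"
proof -
  have L: "triple M (powers_ready (3 * g)) (Assign 4 (Const 0) (Cell 2 (Slots \<kappa>))) [] (positions_ready {})"
    by (rule triple_Assign)
      (use M_bounds in \<open>auto simp: powers_ready_def offsets_ready_def positions_ready_def val_Slots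
        L_def[symmetric] positions_of_def\<close>)
  show ?thesis unfolding Prepare_def
    by (intro triple_Seq_silent[OF triple_offsets] triple_Seq_silent[OF triple_powers]
        triple_Seq_silent[OF L] triple_positions)
qed

lemma ready_upd [simp]: "5 \<le> (x :: nat) \<Longrightarrow> ready P (s(x := f)) = ready P s"
  by (simp add: ready_def)

lemma ready_vals [simp]:
  assumes "ready P s"
  shows "s 3 = P" "val s Nvars = num_vars \<phi>" "val s Nclauses = m" "val s (Nfacilities \<kappa>) = \<kappa> * L"
    "val s j < m \<Longrightarrow> val s (Clen j) = clen (val s j)"
    "val s j < m \<Longrightarrow> val s l < clen (val s j) \<Longrightarrow> val s (Code j l) = code_at \<phi> (val s j) (val s l)"
    "val s (Nverts \<kappa>) = \<kappa> * L + \<kappa> + 1"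
  using assms by (auto simp: ready_def Nvars_def Nclauses_def Nfacilities_def Clen_def Code_def Nverts_def)

definition W where "W = D * (\<kappa> * L + \<kappa> + 1) ^ D * \<kappa> + 1"

lemma val_Weight [simp]: "ready P s \<Longrightarrow> val s (Weight \<kappa> D) = W"
  by (simp add: Weight_def W_def)

lemma num_true_le: "num_true \<phi> \<kappa> P f j n \<le> n"
  unfolding num_true_def by (rule order_trans[OF sum_bounded_above[where K = 1]]) auto

lemma num_unsat_le: "num_unsat \<phi> \<kappa> P f n \<le> n"
  unfolding num_unsat_def by (rule order_trans[OF sum_bounded_above[where K = 1]]) auto

lemma num_true_0 [simp]: "num_true \<phi> \<kappa> P f j 0 = 0"
  by (simp add: num_true_def)

lemma num_unsat_0 [simp]: "num_unsat \<phi> \<kappa> P f 0 = 0"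
  by (simp add: num_unsat_def)

lemma triple_CountUnsat:
  "triple M (\<lambda>s. ready P s \<and> s 5 = h) (CountUnsat \<kappa>) []
    (\<lambda>s. ready P s \<and> s 5 = h \<and> s 9 0 = num_unsat \<phi> \<kappa> P (h 0) m)"
  unfolding CountUnsat_def
proof (rule triple_Seq_silent)
  let ?I = "\<lambda>j s. ready P s \<and> s 5 = h \<and> s 9 0 = num_unsat \<phi> \<kappa> P (h 0) j"
  show "triple M (\<lambda>s. ready P s \<and> s 5 = h) (Assign 9 (Const 0) (Const 0)) [] (?I 0)"
    by (rule triple_Assign) auto
  show "triple M (?I 0) (For 6 Nclauses
      (Seq (Assign 8 (Const 0) (Const 0))
      (Seq (For 7 (Clen (Var 6))
        (Assign 8 (Const 0) (Plus (Var 8)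
          (Eq (ValueAt \<kappa> (Var 5) (Div (Code (Var 6) (Var 7)) (Const 2)))
            (Minus (Const 2) (Mod (Code (Var 6) (Var 7)) (Const 2)))))))
      (Assign 9 (Const 0) (Plus (Var 9)
        (Times (Eq (Mod (Var 6) (Const \<kappa>)) (Mod (Var 5) (Const \<kappa>))) (Minus (Const 1) (Var 8)))))))) [] (?I m)"
  proof (rule triple_For_silent[where I = ?I and n = m])
    fix j :: nat and h' :: "nat \<Rightarrow> nat" assume j: "j < m" "h' 0 = j"
    let ?J = "\<lambda>l s. ?I j s \<and> s 6 = h' \<and> s 8 0 = num_true \<phi> \<kappa> P (h 0) j l"
    have count: "triple M (?J 0) (For 7 (Clen (Var 6))
        (Assign 8 (Const 0) (Plus (Var 8)
          (Eq (ValueAt \<kappa> (Var 5) (Div (Code (Var 6) (Var 7)) (Const 2)))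
            (Minus (Const 2) (Mod (Code (Var 6) (Var 7)) (Const 2))))))) [] (?J (clen j))"
    proof (rule triple_For_silent[where I = ?J and n = "clen j"])
      fix l :: nat and h'' :: "nat \<Rightarrow> nat" assume l: "l < clen j" "h'' 0 = l"
      have Suc: "num_true \<phi> \<kappa> P (h 0) j (Suc l) = num_true \<phi> \<kappa> P (h 0) j l +
          of_bool (value_at \<kappa> P (h 0) (code_at \<phi> j l div 2) = 2 - code_at \<phi> j l mod 2)"
        by (simp add: num_true_def)
      have "num_true \<phi> \<kappa> P (h 0) j (Suc l) \<le> M"
        using num_true_le[of P "h 0" j "Suc l"] l clen_le[OF j(1)] M_bounds by linarith
      then show "triple M (\<lambda>s. ?J l s \<and> s 7 = h'')
        (Assign 8 (Const 0) (Plus (Var 8)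
          (Eq (ValueAt \<kappa> (Var 5) (Div (Code (Var 6) (Var 7)) (Const 2)))
            (Minus (Const 2) (Mod (Code (Var 6) (Var 7)) (Const 2)))))) []
        (\<lambda>s. ?J (Suc l) s \<and> s 7 = h'')"
        by (intro triple_Assign) (use j l M_bounds Suc in auto)
    qed (use j clen_le[OF j(1)] M_bounds in auto)
    have Suc: "num_unsat \<phi> \<kappa> P (h 0) (Suc j) = num_unsat \<phi> \<kappa> P (h 0) j +
        of_bool (j mod \<kappa> = h 0 mod \<kappa>) * (1 - num_true \<phi> \<kappa> P (h 0) j (clen j))"
      by (simp add: num_unsat_def clen_def)
    have le: "num_unsat \<phi> \<kappa> P (h 0) (Suc j) \<le> M"
      using num_unsat_le[of P "h 0" "Suc j"] j M_bounds by linarith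
    show "triple M (\<lambda>s. ?I j s \<and> s 6 = h')
      (Seq (Assign 8 (Const 0) (Const 0))
      (Seq (For 7 (Clen (Var 6))
        (Assign 8 (Const 0) (Plus (Var 8)
          (Eq (ValueAt \<kappa> (Var 5) (Div (Code (Var 6) (Var 7)) (Const 2)))
            (Minus (Const 2) (Mod (Code (Var 6) (Var 7)) (Const 2)))))))
      (Assign 9 (Const 0) (Plus (Var 9)
        (Times (Eq (Mod (Var 6) (Const \<kappa>)) (Mod (Var 5) (Const \<kappa>))) (Minus (Const 1) (Var 8)))))))
      [] (\<lambda>s. ?I (Suc j) s \<and> s 6 = h')"
    proof (rule triple_Seq_silent[OF _ triple_Seq_silent[OF count]])
      show "triple M (\<lambda>s. ?I j s \<and> s 6 = h') (Assign 8 (Const 0) (Const 0)) [] (?J 0)"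
        by (rule triple_Assign) auto
      show "triple M (?J (clen j)) (Assign 9 (Const 0) (Plus (Var 9)
        (Times (Eq (Mod (Var 6) (Const \<kappa>)) (Mod (Var 5) (Const \<kappa>))) (Minus (Const 1) (Var 8)))))
        [] (\<lambda>s. ?I (Suc j) s \<and> s 6 = h')"
      proof (rule triple_Assign)
        let ?e = "Plus (Var 9) (Times (Eq (Mod (Var 6) (Const \<kappa>)) (Mod (Var 5) (Const \<kappa>)))
          (Minus (Const 1) (Var 8)))"
        fix s :: mem assume s: "?J (clen j) s"
        then have "val s ?e = num_unsat \<phi> \<kappa> P (h 0) (Suc j)"
          unfolding Suc using j by simp
        with s le show "val s ?e \<le> M \<and>
          ?I (Suc j) (s(9 := (s 9)(val s (Const 0) := val s ?e))) \<and>
          (s(9 := (s 9)(val s (Const 0) := val s ?e))) 6 = h'"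
          \<comment> \<open>\<open>val s ?e\<close> stays folded so that the computed value can
            replace it as a whole.\<close>
          by (simp del: val_macros val.simps(3-))
      qed (use M_bounds in auto)
    qed
  qed (use M_bounds in auto)
qed

lemma triple_WriteEdges:
  "triple M (ready P) (WriteEdges \<kappa> D)
    ((\<kappa> * L + \<kappa>) # concat (map (\<lambda>f. [f, \<kappa> * L + f mod \<kappa>,
        2 * (1 + num_unsat \<phi> \<kappa> P f (length (clauses \<phi>)) * W), 2]) [0..<\<kappa> * L]) @
      concat (map (\<lambda>i. [\<kappa> * L + i, \<kappa> * L + \<kappa>, 2 * W, 2]) [0..<\<kappa>])) (ready P)"
  unfolding WriteEdges_def
proof (intro triple_Seq_Write triple_Seq)
  show "triple M (ready P)
    (For 5 (Nfacilities \<kappa>)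
      (Seq (CountUnsat \<kappa>)
      (Seq (Write (Var 5))
      (Seq (Write (Plus (Nfacilities \<kappa>) (Mod (Var 5) (Const \<kappa>))))
      (Seq (Write (Times (Const 2) (Plus (Const 1) (Times (Var 9) (Weight \<kappa> D)))))
      (Write (Const 2)))))))
    (concat (map (\<lambda>f. [f, \<kappa> * L + f mod \<kappa>,
        2 * (1 + num_unsat \<phi> \<kappa> P f (length (clauses \<phi>)) * W), 2]) [0..<\<kappa> * L])) (ready P)"
  proof (rule triple_For[where I = "\<lambda>_. ready P"])
    fix f :: nat and h :: "nat \<Rightarrow> nat" assume f: "f < \<kappa> * L" "h 0 = f"
    have "triple M (\<lambda>s. ready P s \<and> s 5 = h \<and> s 9 0 = num_unsat \<phi> \<kappa> P f m)
      (Seq (Write (Var 5))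
      (Seq (Write (Plus (Nfacilities \<kappa>) (Mod (Var 5) (Const \<kappa>))))
      (Seq (Write (Times (Const 2) (Plus (Const 1) (Times (Var 9) (Weight \<kappa> D)))))
      (Write (Const 2)))))
      [f, \<kappa> * L + f mod \<kappa>, 2 * (1 + num_unsat \<phi> \<kappa> P f (length (clauses \<phi>)) * W), 2]
      (\<lambda>s. ready P s \<and> s 5 = h \<and> s 9 0 = num_unsat \<phi> \<kappa> P f m)"
      by (intro triple_Seq_Write triple_Write) (use f M_bounds in \<open>auto simp: m_def[symmetric]\<close>)
    \<comment> \<open>Trades \<open>f\<close> for \<open>h 0\<close> to fit
      \<open>triple_CountUnsat\<close>, and drops the count from the postcondition to fit
      \<open>triple_For\<close>.\<close>
    then have "triple M (\<lambda>s. ready P s \<and> s 5 = h \<and> s 9 0 = num_unsat \<phi> \<kappa> P (h 0) m)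
      (Seq (Write (Var 5))
      (Seq (Write (Plus (Nfacilities \<kappa>) (Mod (Var 5) (Const \<kappa>))))
      (Seq (Write (Times (Const 2) (Plus (Const 1) (Times (Var 9) (Weight \<kappa> D)))))
      (Write (Const 2)))))
      [f, \<kappa> * L + f mod \<kappa>, 2 * (1 + num_unsat \<phi> \<kappa> P f (length (clauses \<phi>)) * W), 2]
      (\<lambda>s. ready P s \<and> s 5 = h)"
      by (rule triple_mono) (use f(2) in auto)
    then show "triple M (\<lambda>s. ready P s \<and> s 5 = h)
      (Seq (CountUnsat \<kappa>)
      (Seq (Write (Var 5))
      (Seq (Write (Plus (Nfacilities \<kappa>) (Mod (Var 5) (Const \<kappa>))))
      (Seq (Write (Times (Const 2) (Plus (Const 1) (Times (Var 9) (Weight \<kappa> D)))))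
      (Write (Const 2))))))
      [f, \<kappa> * L + f mod \<kappa>, 2 * (1 + num_unsat \<phi> \<kappa> P f (length (clauses \<phi>)) * W), 2]
      (\<lambda>s. ready P s \<and> s 5 = h)"
      by (rule triple_Seq_silent[OF triple_CountUnsat])
  qed (use M_bounds in auto)
  show "triple M (ready P) (For 5 (Const \<kappa>)
      (Seq (Write (Plus (Nfacilities \<kappa>) (Var 5)))
      (Seq (Write (Plus (Nfacilities \<kappa>) (Const \<kappa>)))
      (Seq (Write (Times (Const 2) (Weight \<kappa> D)))
      (Write (Const 2))))))
    (concat (map (\<lambda>i. [\<kappa> * L + i, \<kappa> * L + \<kappa>, 2 * W, 2]) [0..<\<kappa>])) (ready P)"
  proof (rule triple_For[where I = "\<lambda>_. ready P"])
    fix i :: nat and h :: "nat \<Rightarrow> nat" assume i: "i < \<kappa>" "h 0 = i"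
    show "triple M (\<lambda>s. ready P s \<and> s 5 = h)
      (Seq (Write (Plus (Nfacilities \<kappa>) (Var 5)))
      (Seq (Write (Plus (Nfacilities \<kappa>) (Const \<kappa>)))
      (Seq (Write (Times (Const 2) (Weight \<kappa> D)))
      (Write (Const 2)))))
      [\<kappa> * L + i, \<kappa> * L + \<kappa>, 2 * W, 2] (\<lambda>s. ready P s \<and> s 5 = h)"
      by (intro triple_Seq_Write triple_Write) (use i M_bounds in auto)
  qed (use M_bounds in auto)
qed (use M_bounds in auto)

lemma triple_WriteGroups:
  "triple M (ready P) (WriteGroups \<kappa>)
    ((1 + num_vars \<phi> * \<kappa> * \<kappa>) # 0 # 0 # 0 # concat (map (\<lambda>q.
      length (filter (in_group \<kappa> P q) [0..<\<kappa> * L]) #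
      concat (map (\<lambda>f. if in_group \<kappa> P q f then [f] else []) [0..<\<kappa> * L]) @ [0, 2])
      [0..<num_vars \<phi> * \<kappa> * \<kappa>])) (ready P)"
  unfolding WriteGroups_def
proof (intro triple_Seq_Write)
  show "triple M (ready P) (For 5 (Times (Times Nvars (Const \<kappa>)) (Const \<kappa>))
      (Seq (Assign 8 (Const 0) (Const 0))
      (Seq (For 6 (Nfacilities \<kappa>) (Assign 8 (Const 0) (Plus (Var 8) (InGroup \<kappa> (Var 5) (Var 6)))))
      (Seq (Write (Var 8))
      (Seq (For 6 (Nfacilities \<kappa>) (Cond (InGroup \<kappa> (Var 5) (Var 6)) (Write (Var 6)) Skip))
      (Seq (Write (Const 0)) (Write (Const 2))))))))
    (concat (map (\<lambda>q.
      length (filter (in_group \<kappa> P q) [0..<\<kappa> * L]) #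
      concat (map (\<lambda>f. if in_group \<kappa> P q f then [f] else []) [0..<\<kappa> * L]) @ [0, 2])
      [0..<num_vars \<phi> * \<kappa> * \<kappa>])) (ready P)"
  proof (rule triple_For[where I = "\<lambda>_. ready P"])
    fix q :: nat and h :: "nat \<Rightarrow> nat" assume q: "q < num_vars \<phi> * \<kappa> * \<kappa>" "h 0 = q"
    let ?A = "\<lambda>s. ready P s \<and> s 5 = h"
    let ?I = "\<lambda>f s. ?A s \<and> s 8 0 = length (filter (in_group \<kappa> P q) [0..<f])"
    show "triple M ?A
      (Seq (Assign 8 (Const 0) (Const 0))
      (Seq (For 6 (Nfacilities \<kappa>) (Assign 8 (Const 0) (Plus (Var 8) (InGroup \<kappa> (Var 5) (Var 6)))))
      (Seq (Write (Var 8))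
      (Seq (For 6 (Nfacilities \<kappa>) (Cond (InGroup \<kappa> (Var 5) (Var 6)) (Write (Var 6)) Skip))
      (Seq (Write (Const 0)) (Write (Const 2)))))))
      (length (filter (in_group \<kappa> P q) [0..<\<kappa> * L]) #
        concat (map (\<lambda>f. if in_group \<kappa> P q f then [f] else []) [0..<\<kappa> * L]) @ [0, 2]) ?A"
    proof (rule triple_Seq_silent[OF _ triple_Seq_silent])
      show "triple M ?A (Assign 8 (Const 0) (Const 0)) [] (?I 0)"
        by (rule triple_Assign) auto
      show "triple M (?I 0) (For 6 (Nfacilities \<kappa>)
        (Assign 8 (Const 0) (Plus (Var 8) (InGroup \<kappa> (Var 5) (Var 6))))) [] (?I (\<kappa> * L))"
      proof (rule triple_For_silent[where I = ?I])
        fix f :: nat and h' :: "nat \<Rightarrow> nat" assume f: "f < \<kappa> * L" "h' 0 = f"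
        have "length (filter (in_group \<kappa> P q) [0..<Suc f]) \<le> M"
          using length_filter_le[of "in_group \<kappa> P q" "[0..<Suc f]"] f M_bounds by simp
        then show "triple M (\<lambda>s. ?I f s \<and> s 6 = h')
          (Assign 8 (Const 0) (Plus (Var 8) (InGroup \<kappa> (Var 5) (Var 6)))) [] (\<lambda>s. ?I (Suc f) s \<and> s 6 = h')"
          by (intro triple_Assign) (use q f M_bounds in auto)
      qed (use M_bounds in auto)
      have members: "triple M ?A
        (For 6 (Nfacilities \<kappa>) (Cond (InGroup \<kappa> (Var 5) (Var 6)) (Write (Var 6)) Skip))
        (concat (map (\<lambda>f. if in_group \<kappa> P q f then [f] else []) [0..<\<kappa> * L])) ?A"
      proof (rule triple_For[where I = "\<lambda>_. ?A"])
        fix f :: nat and h' :: "nat \<Rightarrow> nat" assume f: "f < \<kappa> * L" "h' 0 = f"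
        show "triple M (\<lambda>s. ?A s \<and> s 6 = h') (Cond (InGroup \<kappa> (Var 5) (Var 6)) (Write (Var 6)) Skip)
          (if in_group \<kappa> P q f then [f] else []) (\<lambda>s. ?A s \<and> s 6 = h')"
        proof (rule triple_Cond[where b = "in_group \<kappa> P q f"])
          assume "in_group \<kappa> P q f"
          then show "triple M (\<lambda>s. ?A s \<and> s 6 = h') (Write (Var 6))
            (if in_group \<kappa> P q f then [f] else []) (\<lambda>s. ?A s \<and> s 6 = h')"
            using f by (auto intro!: triple_Write)
        next
          assume "\<not> in_group \<kappa> P q f"
          then show "triple M (\<lambda>s. ?A s \<and> s 6 = h') Skip
            (if in_group \<kappa> P q f then [f] else []) (\<lambda>s. ?A s \<and> s 6 = h')"
            by (auto intro!: triple_Skip)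
        qed (use q f M_bounds in auto)
      qed (use M_bounds in auto)
      have "triple M ?A (Seq (Write (Const 0)) (Write (Const 2))) [0, 2] ?A"
        by (intro triple_Seq_Write triple_Write) (use M_bounds in auto)
      then have "triple M ?A
        (Seq (For 6 (Nfacilities \<kappa>) (Cond (InGroup \<kappa> (Var 5) (Var 6)) (Write (Var 6)) Skip))
        (Seq (Write (Const 0)) (Write (Const 2))))
        (concat (map (\<lambda>f. if in_group \<kappa> P q f then [f] else []) [0..<\<kappa> * L]) @ [0, 2]) ?A"
        by (rule triple_Seq[OF members])
      then have rest: "triple M (?I (\<kappa> * L))
        (Seq (For 6 (Nfacilities \<kappa>) (Cond (InGroup \<kappa> (Var 5) (Var 6)) (Write (Var 6)) Skip))
        (Seq (Write (Const 0)) (Write (Const 2))))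
        (concat (map (\<lambda>f. if in_group \<kappa> P q f then [f] else []) [0..<\<kappa> * L]) @ [0, 2]) ?A"
        by (rule triple_mono) auto
      show "triple M (?I (\<kappa> * L)) (Seq (Write (Var 8))
        (Seq (For 6 (Nfacilities \<kappa>) (Cond (InGroup \<kappa> (Var 5) (Var 6)) (Write (Var 6)) Skip))
        (Seq (Write (Const 0)) (Write (Const 2)))))
        (length (filter (in_group \<kappa> P q) [0..<\<kappa> * L]) #
        concat (map (\<lambda>f. if in_group \<kappa> P q f then [f] else []) [0..<\<kappa> * L]) @ [0, 2]) ?A"
        by (rule triple_Seq_Write[OF _ _ rest]) auto
    qed
  qed (use M_bounds in auto)
qed (use M_bounds in auto)

lemma positions_readyD:
  assumes "positions_ready J s"
  shows "ready (s 3) s" "positions_of \<phi> \<kappa> J (s 3)"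
  using assms unfolding positions_ready_def ready_def by simp_all

text \<open>The table is known only once \<open>Prepare\<close> has halted, hence the existential
  \<open>P\<close>; the output phase is verified for every \<open>P\<close> and instantiated with
  the array 3 found then. The exponent is stated at \<kappa> = 0 to display its uniformity.\<close>

lemma runs_Reduction:
  "\<exists>T P. runs (Reduction \<kappa> D) (enc_cnf \<phi>) T (enc_instance (gadget \<phi> \<kappa> L W P)) \<and>
     T \<le> (M + 2) ^ time_deg (Reduction 0 D) \<and> positions_of \<phi> \<kappa> (occurrences \<phi>) P"
proof -
  let ?clients = "For 5 (Const \<kappa>) (Write (Plus (Nfacilities \<kappa>) (Var 5)))"
  let ?facilities = "For 5 (Nfacilities \<kappa>) (Write (Var 5))"
  let ?write = "Seq (Write (Const \<kappa>)) (Seq (Write (Nverts \<kappa>)) (Seq (Write (Const \<kappa>))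
    (Seq ?clients (Seq (Write (Nfacilities \<kappa>)) (Seq ?facilities
    (Seq (WriteEdges \<kappa> D) (WriteGroups \<kappa>)))))))"
  have clients: "triple M (ready P) ?clients (concat (map (\<lambda>i. [\<kappa> * L + i]) [0..<\<kappa>])) (ready P)" for P
  proof (rule triple_For[where I = "\<lambda>_. ready P"])
    fix i :: nat and h :: "nat \<Rightarrow> nat" assume "i < \<kappa>" "h 0 = i"
    then show "triple M (\<lambda>s. ready P s \<and> s 5 = h) (Write (Plus (Nfacilities \<kappa>) (Var 5)))
      [\<kappa> * L + i] (\<lambda>s. ready P s \<and> s 5 = h)"
      by (intro triple_Write) (use M_bounds in auto)
  qed (use M_bounds in auto)
  have facilities: "triple M (ready P) ?facilities (concat (map (\<lambda>f. [f]) [0..<\<kappa> * L])) (ready P)" for P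
  proof (rule triple_For[where I = "\<lambda>_. ready P"])
    fix f :: nat and h :: "nat \<Rightarrow> nat" assume "f < \<kappa> * L" "h 0 = f"
    then show "triple M (\<lambda>s. ready P s \<and> s 5 = h) (Write (Var 5)) [f] (\<lambda>s. ready P s \<and> s 5 = h)"
      by (intro triple_Write) auto
  qed (use M_bounds in auto)
  have rest: "triple M (ready P) ?write (enc_instance (gadget \<phi> \<kappa> L W P)) (ready P)" for P
    unfolding enc_instance_gadget
    by (rule triple_Seq_Write[OF _ _ triple_Seq_Write[OF _ _ triple_Seq_Write[OF _ _
        triple_Seq[OF clients triple_Seq_Write[OF _ _ triple_Seq[OF facilities
        triple_Seq[OF triple_WriteEdges triple_WriteGroups]]]]]]])
      (use M_bounds in auto)
  let ?out = "\<lambda>(s :: mem) out. \<exists>P. positions_of \<phi> \<kappa> (occurrences \<phi>) P \<and> out = enc_instance (gadget \<phi> \<kappa> L W P)"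
  have "wp M (Prepare \<kappa>) (\<lambda>s out. positions_ready (occurrences \<phi>) s \<and> out = []) (input_mem (enc_cnf \<phi>)) []"
    using triple_Prepare[unfolded triple_def, rule_format, OF mem_le_input refl, of "[]"] by simp
  then have "wp M (Prepare \<kappa>) (wp M ?write ?out) (input_mem (enc_cnf \<phi>)) []"
  proof (rule wp_mono)
    fix s :: mem and out :: "nat list" assume s: "mem_le M s" "positions_ready (occurrences \<phi>) s \<and> out = []"
    from rest[unfolded triple_def, rule_format, OF s(1) positions_readyD(1)[OF conjunct1[OF s(2)]]]
    have "wp M ?write (\<lambda>s' out'. ready (s 3) s' \<and> out' = out @ enc_instance (gadget \<phi> \<kappa> L W (s 3))) s out" .
    then show "wp M ?write ?out s out"
      by (rule wp_mono) (use s(2) positions_readyD(2) in auto)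
  qed
  then have "wp M (Reduction \<kappa> D) ?out (input_mem (enc_cnf \<phi>)) []"
    unfolding Reduction_def by (rule wp_Seq)
  then show ?thesis unfolding wp_def runs_def time_deg_Reduction[of \<kappa> _ 0] by blast
qed

end

section \<open>Finding a feasible solution\<close>

definition WriteInitial :: com where
  "WriteInitial = For 1 (Cell 0 (Const 1)) (Write (Cell 1 (Const 0)))"

text \<open>Here \<open>wp\<close> would be too coarse: its \<open>M\<close> dominates all input
  cells, and for arbitrary instances the weights among them can be exponential in the input size.
  The time is therefore counted directly in terms of the first entry, k.\<close>

lemma runs_WriteInitial:
  assumes "xs \<noteq> []"
  shows "\<exists>T. runs WriteInitial xs T [0..<hd xs] \<and> T \<le> (hd xs + 2) * (6 * hd xs + 20)"
proof -
  define k where "k = hd xs"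
  let ?e = "Minus (Cell 1 (Const 1)) (Cell 1 (Const 0))"
  let ?inc = "Assign 1 (Const 0) (Plus (Cell 1 (Const 0)) (Const 1))"
  let ?body = "Seq (Write (Cell 1 (Const 0))) ?inc"
  have loop: "\<exists>T s'. exec (While ?e ?body) (s, out) T (s', out @ [i..<k]) \<and>
      T \<le> (k - i) * (6 * k + 20) + (6 * k + 10)" if "i \<le> k" "s 1 0 = i" "s 1 1 = k" for i s out
    using that
  proof (induction "k - i" arbitrary: i s out)
    case 0
    have "ecost s ?e \<le> 6 * k + 10"
      using 0 bits_le[of 1] bits_le[of 0] bits_le[of k] by simp
    then show ?case using exec.WhileFalse[of "(s, out)" ?e ?body] 0
      by (intro exI[of _ "ecost s ?e"] exI[of _ s]) auto
  next
    case (Suc d)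
    then have i: "i < k" by simp
    have d: "d = k - Suc i" using Suc.hyps(2) by simp
    let ?s = "s(1 := (s 1)(0 := i + 1))"
    obtain T s' where T: "exec (While ?e ?body) (?s, out @ [i]) T (s', (out @ [i]) @ [Suc i..<k])"
      "T \<le> (k - Suc i) * (6 * k + 20) + (6 * k + 10)"
      using Suc.hyps(1)[of "Suc i" ?s "out @ [i]", OF d] i Suc.prems(3) by auto
    have inc: "exec ?inc (s, out @ [i]) (ecost s (Const 0) + ecost s (Plus (Cell 1 (Const 0)) (Const 1)))
        (?s, out @ [i])"
      using exec.Assign[of 1 "Const 0" "Plus (Cell 1 (Const 0)) (Const 1)" s "out @ [i]"] Suc.prems by simp
    have "exec (Write (Cell 1 (Const 0))) (s, out) (ecost s (Cell 1 (Const 0))) (s, out @ [i])"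
      using exec.Write[of "Cell 1 (Const 0)" s out] Suc.prems by simp
    from exec.WhileTrue[of "(s, out)" ?e, OF _ exec.Seq[OF this inc] T(1)]
    have "exec (While ?e ?body) (s, out) (ecost s ?e + (ecost s (Cell 1 (Const 0)) +
        (ecost s (Const 0) + ecost s (Plus (Cell 1 (Const 0)) (Const 1)))) + T)
        (s', out @ [i..<k])"
      using Suc.prems i by (simp add: upt_conv_Cons)
    moreover have "ecost s ?e + (ecost s (Cell 1 (Const 0)) +
        (ecost s (Const 0) + ecost s (Plus (Cell 1 (Const 0)) (Const 1)))) \<le> 6 * k + 20"
      using Suc.prems i bits_le[of 1] bits_le[of 0] bits_le[of k] bits_le[of i] bits_le[of "k - i"]
        bits_le[of "i + 1"] by simp
    moreover have "k - i = Suc (k - Suc i)" using i by simp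
    ultimately show ?case using T(2)
      by (intro exI[of _ s'] exI conjI) auto
  qed
  let ?init = "input_mem xs" and ?bnd = "Cell 0 (Const 1)"
  let ?mid = "?init(1 := (?init 1)(1 := k))"
  let ?start = "?mid(1 := (?mid 1)(0 := 0))"
  have k: "?init 0 1 = k" using assms by (cases xs) (auto simp: input_mem_def k_def)
  have "exec (Assign 1 (Const 1) ?bnd) (?init, []) (ecost ?init (Const 1) + ecost ?init ?bnd) (?mid, [])"
    using exec.Assign[of 1 "Const 1" ?bnd ?init "[]"] k by simp
  moreover have "exec (Assign 1 (Const 0) (Const 0)) (?mid, []) (ecost ?mid (Const 0) + ecost ?mid (Const 0)) (?start, [])"
    using exec.Assign[of 1 "Const 0" "Const 0" ?mid "[]"] by simp
  moreover obtain T s' where "exec (While ?e ?body) (?start, []) T (s', [] @ [0..<k])"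
    and T: "T \<le> k * (6 * k + 20) + (6 * k + 10)"
    using loop[of 0 ?start "[]"] by auto
  ultimately have "exec WriteInitial (?init, []) (ecost ?init (Const 1) + ecost ?init ?bnd +
      (ecost ?mid (Const 0) + ecost ?mid (Const 0) + T)) (s', [0..<k])"
    unfolding WriteInitial_def For_def by (auto intro: exec.Seq)
  moreover have "ecost ?init (Const 1) + ecost ?init ?bnd + (ecost ?mid (Const 0) + ecost ?mid (Const 0) + T)
      \<le> (k + 2) * (6 * k + 20)"
    using T k bits_le[of 1] bits_le[of 0] bits_le[of k] by (simp add: add_mult_distrib)
  ultimately show ?thesis unfolding runs_def k_def[symmetric] by blast
qed

lemma length_le_input_size: "length xs \<le> input_size xs"
proof (induction xs)
  case (Cons x xs)
  then show ?case using bits_pos[of x] by (simp add: input_size_def)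
qed (simp add: input_size_def)

lemma length_facilities_le: "length (facilities I) \<le> length (enc_instance I)"
proof -
  have "length (concat (map (\<lambda>v. [v]) vs)) = length vs" for vs :: "nat list"
    by (induction vs) auto
  then show ?thesis by (simp add: enc_instance_def enc_list_def)
qed

text \<open>As k is given in binary, writing k numbers might take exponential time. But feasibility
  of {0..<k} provides k facilities, each with its own entry in the encoding, so k is at most the
  input size.\<close>

lemma fr_k_med_O_initial: "fr_k_med_O {I. fr_k_med I \<and> feasible I {0..<bound_k I}}"
proof -
  have "\<exists>T ys. runs WriteInitial (enc_instance I) T ys \<and>
      T \<le> poly ([:2, 1:] * [:20, 6:]) (input_size (enc_instance I)) \<and> feasible I (set ys)"
    if feas: "feasible I {0..<bound_k I}" for I
  proof -
    have hd: "enc_instance I \<noteq> []" "hd (enc_instance I) = bound_k I" by (simp_all add: enc_instance_def)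
    have "bound_k I = card {0..<bound_k I}" by simp
    also have "\<dots> \<le> card (set (facilities I))"
      using feas by (intro card_mono) (auto simp: feasible_def)
    also have "\<dots> \<le> input_size (enc_instance I)"
      using card_length[of "facilities I"] length_facilities_le[of I]
        length_le_input_size[of "enc_instance I"] by linarith
    finally have k: "bound_k I \<le> input_size (enc_instance I)" .
    obtain T where T: "runs WriteInitial (enc_instance I) T [0..<bound_k I]"
      "T \<le> (bound_k I + 2) * (6 * bound_k I + 20)"
      using runs_WriteInitial[OF hd(1)] unfolding hd(2) by blast
    have "(bound_k I + 2) * (6 * bound_k I + 20) \<le>
        (input_size (enc_instance I) + 2) * (6 * input_size (enc_instance I) + 20)"
      using k by (intro mult_le_mono add_le_mono) auto
    also have "\<dots> = poly ([:2, 1:] * [:20, 6:]) (input_size (enc_instance I))"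
      unfolding poly_mult by (simp add: algebra_simps)
    finally show ?thesis using T feas
      by (intro exI[of _ T] exI[of _ "[0..<bound_k I]"]) auto
  qed
  then show ?thesis unfolding fr_k_med_O_def by blast
qed

section \<open>Size and time estimates\<close>

text \<open>For x \<ge> 1 powers grow with the exponent, so a single number can serve as coefficient
  and exponent, and the program has one parameter for p.\<close>

lemma poly_le_monomial:
  fixes p :: "real poly"
  shows "\<exists>D::nat. \<forall>x::nat. 1 \<le> x \<longrightarrow> poly p (real x) \<le> real (D * x ^ D)"
proof (induction p)
  case 0
  then show ?case by auto
next
  case (pCons a p)
  then obtain D :: nat where D: "\<And>x. 1 \<le> x \<Longrightarrow> poly p (real x) \<le> real (D * x ^ D)" by blast
  obtain A :: nat where A: "a \<le> real A" using real_arch_simple by blast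
  have "poly (pCons a p) (real x) \<le> real ((A + D + 1) * x ^ (A + D + 1))" if "1 \<le> x" for x :: nat
  proof -
    have "real A \<le> real (A * x ^ (A + D + 1))"
      using mult_le_mono2[OF one_le_power[OF that], of A "A + D + 1"] by (intro of_nat_mono) simp
    moreover have "real x * poly p (real x) \<le> real (D * x ^ (A + D + 1))"
    proof -
      have "real x * poly p (real x) \<le> real x * real (D * x ^ D)"
        using D[OF that] by (intro mult_left_mono) auto
      also have "\<dots> = real (D * x ^ (D + 1))" by simp
      also have "\<dots> \<le> real (D * x ^ (A + D + 1))"
        using that by (intro of_nat_mono mult_le_mono2 power_increasing) auto
      finally show ?thesis .
    qed
    moreover have "A * x ^ (A + D + 1) + D * x ^ (A + D + 1) \<le> (A + D + 1) * x ^ (A + D + 1)"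
      by (simp add: add_mult_distrib)
    ultimately show ?thesis using A unfolding poly_pCons by linarith
  qed
  then show ?case by blast
qed

text \<open>The base is at most C * Y^3 * 2^(3 g). In \<open>c\<close> the summands in parentheses
  pay for C, for 2^(3 g) by the bound on g, and for Y^3; constants move into the exponent of 2
  because R \<ge> 1.\<close>

lemma time_bound:
  fixes \<kappa> n m b D g K T :: nat and R :: real
  defines "R \<equiv> max 1 (real n / real \<kappa>)" and "Y \<equiv> max n \<kappa>"
  assumes "0 < \<kappa>" "m \<le> b * n" and g: "real g \<le> real (b + 1) * R"
    and T: "T \<le> (4 * m + 2 * n + n * \<kappa> * \<kappa> + \<kappa> + D + 4 + \<kappa> * 2 ^ (3 * g) + 2) ^ K"
    and c: "c = K * (4 * b + D + 11 + 3 * (b + 1) + 3)"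
  shows "real T \<le> 2 powr (real c * R) * real Y ^ c"
proof -
  define L :: nat where "L = 2 ^ (3 * g)"
  define Z where "Z = Y ^ 3 * L"
  \<comment> \<open>The sum of the coefficients when every summand of the base is bounded by a
    multiple of \<open>Z\<close>: 4 b + 2 + 1 + 1 + D + 4 + 1 + 2.\<close>
  define C where "C = 4 * b + D + 11"
  have Y: "1 \<le> Y" "n \<le> Y" "\<kappa> \<le> Y" using assms(3) by (auto simp: Y_def)
  have L: "1 \<le> L" by (simp add: L_def)
  have R: "1 \<le> R" by (simp add: R_def)
  have Y1: "Y \<le> Y ^ 3" using Y(1) by (intro self_le_power) auto
  have Y3: "Y ^ 3 \<le> Z" using L by (simp add: Z_def)
  have Z: "Y \<le> Z" "1 \<le> Z" using Y1 Y3 Y(1) by linarith+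
  have "n * \<kappa> * \<kappa> \<le> Z"
  proof -
    have "n * \<kappa> * \<kappa> \<le> Y * Y * Y" using Y by (intro mult_le_mono) auto
    then show ?thesis using Y3 by (simp add: power3_eq_cube)
  qed
  moreover have "\<kappa> * L \<le> Z" using Y1 Y(3) by (simp add: Z_def)
  moreover have "4 * m \<le> 4 * b * Z"
  proof -
    have "m \<le> b * Z" using assms(4) Y(2) Z(1) by (meson le_trans mult_le_mono2)
    then show ?thesis by simp
  qed
  moreover have "D \<le> D * Z" using Z(2) by simp
  ultimately have "4 * m + 2 * n + n * \<kappa> * \<kappa> + \<kappa> + D + 4 + \<kappa> * L + 2 \<le> C * Z"
    using Y Z unfolding C_def add_mult_distrib by linarith
  then have "T \<le> (C * Z) ^ K"
    using T unfolding L_def[symmetric] by (meson le_trans power_mono zero_le)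
  then have "real T \<le> real ((C * Z) ^ K)" by (rule of_nat_mono)
  also have "\<dots> = real C ^ K * real L ^ K * real Y ^ (3 * K)"
    by (simp add: Z_def power_mult_distrib power_mult[symmetric] mult.commute)
  also have "\<dots> \<le> 2 powr (real (K * C) + real (3 * g * K)) * real Y ^ c"
  proof (rule mult_mono)
    have "real C \<le> 2 powr real C" using of_nat_less_two_power[of C, where 'a = real] by (simp add: powr_realpow)
    then have "real C ^ K \<le> (2 powr real C) ^ K" by (intro power_mono) auto
    also have "\<dots> = 2 powr real (K * C)" by (simp add: powr_power mult.commute)
    finally have "real C ^ K \<le> 2 powr real (K * C)" .
    moreover have "real L ^ K = 2 powr real (3 * g * K)"
      unfolding L_def powr_realpow[OF zero_less_numeral] by (simp add: power_mult)
    ultimately show "real C ^ K * real L ^ K \<le> 2 powr (real (K * C) + real (3 * g * K))"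
      unfolding powr_add by (intro mult_mono) auto
    show "real Y ^ (3 * K) \<le> real Y ^ c"
      using Y(1) by (intro power_increasing) (auto simp: c algebra_simps)
  qed auto
  also have "\<dots> \<le> 2 powr (real c * R) * real Y ^ c"
  proof (rule mult_right_mono)
    have "real (K * C) \<le> real (K * C) * R" using mult_left_mono[OF R, of "real (K * C)"] by simp
    moreover have "real (3 * g * K) \<le> real (3 * (b + 1) * K) * R"
      using mult_left_mono[OF g, of "real (3 * K)"] by (simp add: algebra_simps)
    moreover have "(real (K * C) + real (3 * (b + 1) * K)) * R \<le> real c * R"
      using R by (intro mult_right_mono) (auto simp: c C_def algebra_simps)
    ultimately have "real (K * C) + real (3 * g * K) \<le> real c * R"
      unfolding distrib_right by linarith
    then show "2 powr (real (K * C) + real (3 * g * K)) \<le> 2 powr (real c * R)" by simp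
  qed simp
  finally show ?thesis .
qed

theorem theorem10:
  fixes p :: "real poly" and \<epsilon> B :: real
  assumes "\<And>x::nat. poly p (real x) \<ge> 1"
    and "0 < \<epsilon>" and "\<epsilon> \<le> 1"
  shows "\<exists>(c::nat) \<O>. fr_k_med_O \<O> \<and>
    (\<forall>\<kappa>::nat. \<kappa> > 0 \<longrightarrow> (\<exists>A::com. \<forall>\<phi>::cnf.
      three_cnf \<phi> \<and> real (length (clauses \<phi>)) \<le> B * real (num_vars \<phi>) \<longrightarrow>
      (\<exists>T I. runs A (enc_cnf \<phi>) T (enc_instance I) \<and>
        real T \<le> 2 powr (real c * max 1 (real (num_vars \<phi>) / real \<kappa>))
                   * real (max (num_vars \<phi>) \<kappa>) ^ c \<and>
        I \<in> \<O> \<and>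
        card (set (clients I)) = \<kappa> \<and>
        (\<exists>x::real. 0 \<le> x \<and> x \<le> real c * max 1 (real (num_vars \<phi>) / real \<kappa>) \<and>
           real (card (set (facilities I))) = real \<kappa> * 2 powr x \<and>
           real (num_verts I) = real \<kappa> * (2 powr x + 1) + 1) \<and>
        bound_k I = \<kappa> \<and>
        length (groups I) \<le> \<kappa> + 2 * num_vars \<phi> * \<kappa>\<^sup>2 \<and>
        ((\<exists>\<sigma>. num_sat \<sigma> \<phi> = length (clauses \<phi>)) \<longrightarrow>
           (\<exists>S. feasible I S \<and> cost I S \<le> ereal (real (bound_k I)))) \<and>
        ((\<forall>\<sigma>. real (num_sat \<sigma> \<phi>) < (1 - \<epsilon>) * real (length (clauses \<phi>))) \<longrightarrow>
           (\<forall>S. feasible I S \<longrightarrow>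
              cost I S > ereal (poly p (real (num_verts I)) * real (bound_k I)))))))"
proof -
  obtain D :: nat where D: "\<And>x. 1 \<le> x \<Longrightarrow> poly p (real x) \<le> real (D * x ^ D)"
    using poly_le_monomial by blast
  obtain b :: nat where b: "B \<le> real b" using real_arch_simple by blast
  \<comment> \<open>Fixed before \<kappa>, as is \<open>c\<close>: all \<kappa> share this exponent,
    and \<kappa> = 0 stands for them.\<close>
  define K where "K = time_deg (Reduction 0 D)"
  define c where "c = K * (4 * b + D + 11 + 3 * (b + 1) + 3)"
  have K: "1 \<le> K" using time_deg_pos[of "Reduction 0 D"] by (simp add: K_def)
  show ?thesis
  proof (intro exI[of _ c] exI[of _ "{I. fr_k_med I \<and> feasible I {0..<bound_k I}}"] conjI
      fr_k_med_O_initial allI impI)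
    fix \<kappa> :: nat assume \<kappa>: "0 < \<kappa>"
    show "\<exists>A. \<forall>\<phi>. three_cnf \<phi> \<and> real (length (clauses \<phi>)) \<le> B * real (num_vars \<phi>) \<longrightarrow>
      (\<exists>T I. runs A (enc_cnf \<phi>) T (enc_instance I) \<and>
        real T \<le> 2 powr (real c * max 1 (real (num_vars \<phi>) / real \<kappa>))
                   * real (max (num_vars \<phi>) \<kappa>) ^ c \<and>
        I \<in> {I. fr_k_med I \<and> feasible I {0..<bound_k I}} \<and>
        card (set (clients I)) = \<kappa> \<and>
        (\<exists>x::real. 0 \<le> x \<and> x \<le> real c * max 1 (real (num_vars \<phi>) / real \<kappa>) \<and>
           real (card (set (facilities I))) = real \<kappa> * 2 powr x \<and>
           real (num_verts I) = real \<kappa> * (2 powr x + 1) + 1) \<and>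
        bound_k I = \<kappa> \<and>
        length (groups I) \<le> \<kappa> + 2 * num_vars \<phi> * \<kappa>\<^sup>2 \<and>
        ((\<exists>\<sigma>. num_sat \<sigma> \<phi> = length (clauses \<phi>)) \<longrightarrow>
           (\<exists>S. feasible I S \<and> cost I S \<le> ereal (real (bound_k I)))) \<and>
        ((\<forall>\<sigma>. real (num_sat \<sigma> \<phi>) < (1 - \<epsilon>) * real (length (clauses \<phi>))) \<longrightarrow>
           (\<forall>S. feasible I S \<longrightarrow>
              cost I S > ereal (poly p (real (num_verts I)) * real (bound_k I)))))"
    proof (intro exI[of _ "Reduction \<kappa> D"] allI impI, elim conjE)
      fix \<phi> :: cnf
      assume three: "three_cnf \<phi>" and few: "real (length (clauses \<phi>)) \<le> B * real (num_vars \<phi>)"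
      let ?R = "max 1 (real (num_vars \<phi>) / real \<kappa>)"
      \<comment> \<open>The least admissible \<open>M\<close>, which is the sum estimated by
        \<open>time_bound\<close>.\<close>
      interpret reduction_run \<phi> \<kappa> D "4 * length (clauses \<phi>) + 2 * num_vars \<phi> + num_vars \<phi> * \<kappa> * \<kappa> + \<kappa> + D + 4
          + \<kappa> * 2 ^ (3 * ((length (clauses \<phi>) + (\<kappa> - 1)) div \<kappa>))"
        by unfold_locales (use \<kappa> three in auto)
      obtain T P where run: "runs (Reduction \<kappa> D) (enc_cnf \<phi>) T (enc_instance (gadget \<phi> \<kappa> L W P))"
        and T: "T \<le> (4 * m + 2 * num_vars \<phi> + num_vars \<phi> * \<kappa> * \<kappa> + \<kappa> + D + 4 + \<kappa> * 2 ^ (3 * g) + 2) ^ K"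
        and P: "positions_of \<phi> \<kappa> (occurrences \<phi>) P"
        using runs_Reduction unfolding K_def g_def m_def by blast
      let ?I = "gadget \<phi> \<kappa> L W P"
      have "real m \<le> real (b * num_vars \<phi>)"
        using few mult_right_mono[OF b, of "real (num_vars \<phi>)"] by (simp add: m_def)
      then have m_le: "m \<le> b * num_vars \<phi>" by (simp only: of_nat_le_iff)
      \<comment> \<open>Rounding up adds less than 1 to m / \<kappa>; the maximum with 1 absorbs
        this even if \<kappa> exceeds n'.\<close>
      have g_le: "real g \<le> real (b + 1) * ?R"
      proof -
        have "g * \<kappa> \<le> m + (\<kappa> - 1)" by (simp add: g_def)
        also have "\<dots> \<le> b * num_vars \<phi> + \<kappa>" using m_le by simp
        finally have "real (g * \<kappa>) \<le> real (b * num_vars \<phi> + \<kappa>)" by (rule of_nat_mono)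
        then have "real g \<le> real b * (real (num_vars \<phi>) / real \<kappa>) + 1"
          using \<kappa> by (simp add: field_simps)
        also have "\<dots> \<le> real b * ?R + ?R" by (intro add_mono mult_left_mono) auto
        finally show ?thesis by (simp add: algebra_simps)
      qed
      have time: "real T \<le> 2 powr (real c * ?R) * real (max (num_vars \<phi>) \<kappa>) ^ c"
        by (rule time_bound[OF \<kappa> m_le g_le T c_def])
      have x: "real (3 * g) \<le> real c * ?R"
      proof -
        have "3 * (b + 1) \<le> 1 * (4 * b + D + 11 + 3 * (b + 1) + 3)" by simp
        also have "\<dots> \<le> c" unfolding c_def by (rule mult_le_mono1[OF K])
        finally have "3 * (b + 1) \<le> c" .
        then have "real (3 * (b + 1)) * ?R \<le> real c * ?R" by (intro mult_right_mono of_nat_mono) auto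
        then show ?thesis using g_le by (simp add: algebra_simps)
      qed
      have L_powr: "2 powr real (3 * g) = real L"
        unfolding L_def powr_realpow[OF zero_less_numeral] by simp
      have sizes: "\<exists>x::real. 0 \<le> x \<and> x \<le> real c * ?R \<and>
           real (card (set (facilities ?I))) = real \<kappa> * 2 powr x \<and>
           real (num_verts ?I) = real \<kappa> * (2 powr x + 1) + 1"
        using x by (intro exI[of _ "real (3 * g)"]) (simp only: L_powr, simp add: algebra_simps)
      have "length (groups ?I) = 1 + num_vars \<phi> * \<kappa>\<^sup>2"
        by (simp add: gadget_def power2_eq_square mult.assoc)
      \<comment> \<open>The extra empty group is paid for by \<kappa> \<ge> 1.\<close>
      then have num_groups: "length (groups ?I) \<le> \<kappa> + 2 * num_vars \<phi> * \<kappa>\<^sup>2" using \<kappa> by simp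
      have "L > 0" "W > 0" by (simp_all add: L_def W_def)
      then have inst: "fr_k_med ?I" "feasible ?I {0..<bound_k ?I}"
        using fr_k_med_gadget[OF \<kappa>] feasible_gadget_initial[OF \<kappa>] by simp_all
      have complete: "\<exists>S. feasible ?I S \<and> cost ?I S \<le> ereal (real (bound_k ?I))"
        if "\<exists>\<sigma>. num_sat \<sigma> \<phi> = length (clauses \<phi>)"
        using that gadget_complete[OF \<kappa> three clauses_le[unfolded m_def] P, of _ W]
        unfolding L_def[symmetric] by auto
      have sound: "cost ?I S > ereal (poly p (real (num_verts ?I)) * real (bound_k ?I))"
        if gap: "\<forall>\<sigma>. real (num_sat \<sigma> \<phi>) < (1 - \<epsilon>) * real (length (clauses \<phi>))" and feas: "feasible ?I S" for S
      proof (rule ccontr)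
        assume "\<not> ?thesis"
        then have "cost ?I S \<le> ereal (poly p (real (num_verts ?I)) * real (bound_k ?I))" by simp
        also have "\<dots> < ereal (real W)"
        proof -
          have "poly p (real (num_verts ?I)) * real \<kappa> \<le> real (D * num_verts ?I ^ D) * real \<kappa>"
            using D[of "num_verts ?I"] by (intro mult_right_mono) auto
          also have "\<dots> < real W" by (simp add: W_def)
          finally show ?thesis by simp
        qed
        finally obtain \<sigma> where "num_sat \<sigma> \<phi> = length (clauses \<phi>)"
          using gadget_sound[OF \<kappa> three feas] by blast
        with gap have "real (length (clauses \<phi>)) < (1 - \<epsilon>) * real (length (clauses \<phi>))" by metis
        moreover have "(1 - \<epsilon>) * real (length (clauses \<phi>)) \<le> 1 * real (length (clauses \<phi>))"
          using assms(2) by (intro mult_right_mono) auto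
        ultimately show False by simp
      qed
      have "card (set (clients ?I)) = \<kappa>" "bound_k ?I = \<kappa>" by simp_all
      then show "\<exists>T I. runs (Reduction \<kappa> D) (enc_cnf \<phi>) T (enc_instance I) \<and>
        real T \<le> 2 powr (real c * ?R) * real (max (num_vars \<phi>) \<kappa>) ^ c \<and>
        I \<in> {I. fr_k_med I \<and> feasible I {0..<bound_k I}} \<and>
        card (set (clients I)) = \<kappa> \<and>
        (\<exists>x::real. 0 \<le> x \<and> x \<le> real c * ?R \<and>
           real (card (set (facilities I))) = real \<kappa> * 2 powr x \<and>
           real (num_verts I) = real \<kappa> * (2 powr x + 1) + 1) \<and>
        bound_k I = \<kappa> \<and>
        length (groups I) \<le> \<kappa> + 2 * num_vars \<phi> * \<kappa>\<^sup>2 \<and>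
        ((\<exists>\<sigma>. num_sat \<sigma> \<phi> = length (clauses \<phi>)) \<longrightarrow>
           (\<exists>S. feasible I S \<and> cost I S \<le> ereal (real (bound_k I)))) \<and>
        ((\<forall>\<sigma>. real (num_sat \<sigma> \<phi>) < (1 - \<epsilon>) * real (length (clauses \<phi>))) \<longrightarrow>
           (\<forall>S. feasible I S \<longrightarrow>
              cost I S > ereal (poly p (real (num_verts I)) * real (bound_k I))))"
        using run time inst sizes num_groups complete sound
        by (intro exI[of _ T] exI[of _ ?I] conjI CollectI impI allI) simp_all
    qed
  qed
qed

end
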